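(* Let $d\ge1$. Suppose that $S:\mathbb{Z}^d\to[0,\infty)$ satisfies Assumption 1 and the weakened Assumption 2 (stated in the context), the latter with functions $J,h$ and constants $M,K_{\mathrm{IR}},\zeta>0$. Then the set $\overline\Omega$ is strictly convex, and every $\mu\in\overline\Omega$ obeys $|\mu|^2\le M/K_{\mathrm{IR}}$. For each $\mu\in\overline\Omega$, we have $$\sum_{y\in\mathbb{Z}^d}J^{(\mu)}(y)\le1\quad\text{with equality if and only if }\mu\in\partial\Omega.$$ For each nonzero $x\in\mathbb{R}^d$, there is a unique vector $\mu_{\hat x}\in\partial\Omega$, depending only on the direction $\hat x=x/|x|$ of $x$, such that $$\mu_{\hat x}\cdot x=\max_{\mu\in\overline\Omega}\mu\cdot x.$$ The vector $\eta_{\hat x}\in\mathbb{R}^d$ with components $\eta_{\hat x,j}=\sum_{y\in\mathbb{Z}^d}y_jJ^{(\mu_{\hat x})}(y)$ satisfies $\eta_{\hat x}=|\eta_{\hat x}|\hat x$. Also, with the matrix $\Lambda_{\hat x}$ defined by $\Lambda_{\hat x,jl}=\sum_{y\in\mathbb{Z}^d}y_jy_lJ^{(\mu_{\hat x})}(y)$, we have $$\mu_{\hat x}\cdot x\asymp m_S|x|,\qquad|\eta_{\hat x}|\asymp m_S,\qquad k\cdot\Lambda_{\hat x}k\asymp|k|^2\quad(k\in\mathbb{R}^d),$$ with constants depending only on $d,M,K_{\mathrm{IR}}$.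
   Context: Notation. $|x|=\|x\|_2$ is the Euclidean norm on $\mathbb{R}^d$; $a\wedge b=\min\{a,b\}$; $f\asymp g$ means $cg\le f\le Cg$ for some constants $c,C>0$; $e_1,\dots,e_d$ is the standard basis; $\mathbb{T}^d$ is the $d$-dimensional torus of period $2\pi$. For $f,g:\mathbb{Z}^d\to\mathbb{R}$: $\hat f(k)=\sum_{x}f(x)e^{-ik\cdot x}$, $(f*g)(x)=\sum_{y}f(x-y)g(y)$, and $\|f(y)\|_p$ is the $\ell^p(\mathbb{Z}^d)$ norm. $f$ is $\mathbb{Z}^d$-symmetric if $f(x)$ is unchanged when a component of $x$ is multiplied by $-1$ or the components of $x$ are permuted. The exponential tilt of $f$ by $\mu\in\mathbb{R}^d$ is $f^{(\mu)}(x)=f(x)e^{\mu\cdot x}$. For $S:\mathbb{Z}^d\to[0,\infty)$ let $\chi^{(\mu)}=\sum_{x}S^{(\mu)}(x)$, $\Omega=\{\mu\in\mathbb{R}^d:\chi^{(\mu)}<\infty\}$, with closure $\overline\Omega$ and boundary $\partial\Omega$, and $m_S=\sup\{t\ge0:\chi^{(te_1)}<\infty\}$. Assumption 1: $S$ is $\mathbb{Z}^d$-symmetric, $\Omega$ is an open set containing $0$, and $\mu_1e_1\notin\Omega$ for some $\mu_1>0$. Weakened Assumption 2 (with constants $M,K_{\mathrm{IR}},\zeta>0$): $S=h+J*S$ with $\mathbb{Z}^d$-symmetric $J,h\in\ell^1(\mathbb{Z}^d)$; for every $\mu\in\overline\Omega$ one has $\hat h^{(\mu)}(0)>0$ and the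 pair $(Q,g)=(J^{(\mu)},h^{(\mu)})$ satisfies, with the same constants for all $\mu$, (a) $\|Q(y)\|_1\le M$ and $\||y|^{2+\zeta}Q(y)\|_1\le M$; (b) $\mathrm{Re}[\hat Q(0)-\hat Q(k)]\ge K_{\mathrm{IR}}|k|^2$ for $k\in\mathbb{T}^d$ (represented in $[-\pi,\pi]^d$); (c) $\|g(y)\|_1\le M$, $\||y|^{\zeta}g(y)\|_1\le M$, $\||y|^2g(y)\|_{p_d\wedge2}\le M$, where $p_d=2$ for $d=1$ and $p_d=\frac{d}{d-2+(\zeta\wedge2)}$ for $d\ge2$. *)

theory Defs
  imports "HOL-Analysis.Analysis"
begin

text \<open>
  The lattice $\mathbb{Z}^d$ is the type \<^typ>\<open>int ^ 'n\<close> and $\mathbb{R}^d$ is \<^typ>\<open>real ^ 'n\<close>,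
  with $d$ the cardinality of the index type \<open>'n\<close>. That type has no distinguished first element,
  so $e_1$ is written \<open>axis i 1\<close>, where the index \<open>i\<close> is an explicit parameter naming
  the first coordinate.
\<close>

definition emb :: "int ^ 'n \<Rightarrow> real ^ 'n"
  where "emb x = (\<chi> j. real_of_int (x $ j))"

definition tilt :: "real ^ 'n \<Rightarrow> (int ^ 'n \<Rightarrow> real) \<Rightarrow> int ^ 'n \<Rightarrow> real"
  where "tilt \<mu> f x = f x * exp (\<mu> \<bullet> emb x)"

definition fourier :: "(int ^ 'n \<Rightarrow> real) \<Rightarrow> real ^ 'n \<Rightarrow> complex"
  where "fourier f k = (\<Sum>\<^sub>\<infinity>x. of_real (f x) * exp (- (\<i> * of_real (k \<bullet> emb x))))"

definition conv :: "(int ^ 'n \<Rightarrow> real) \<Rightarrow> (int ^ 'n \<Rightarrow> real) \<Rightarrow> int ^ 'n \<Rightarrow> real"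
  where "conv f g x = (\<Sum>\<^sub>\<infinity>y. f (x - y) * g y)"

text \<open>
  \<open>in_lp\<close> is kept separate from the value of the norm because \<^const>\<open>infsum\<close>
  is \<open>0\<close> on families that are not summable.
\<close>

definition in_lp :: "real \<Rightarrow> (int ^ 'n \<Rightarrow> real) \<Rightarrow> bool"
  where "in_lp p f \<longleftrightarrow> (\<lambda>y. \<bar>f y\<bar> powr p) summable_on UNIV"

definition lp_norm :: "real \<Rightarrow> (int ^ 'n \<Rightarrow> real) \<Rightarrow> real"
  where "lp_norm p f = (\<Sum>\<^sub>\<infinity>y. \<bar>f y\<bar> powr p) powr (1 / p)"

definition lp_norm_le :: "real \<Rightarrow> (int ^ 'n \<Rightarrow> real) \<Rightarrow> real \<Rightarrow> bool"
  where "lp_norm_le p f B \<longleftrightarrow> in_lp p f \<and> lp_norm p f \<le> B"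

definition Zd_symmetric :: "(int ^ 'n \<Rightarrow> real) \<Rightarrow> bool"
  where "Zd_symmetric f \<longleftrightarrow>
    (\<forall>i x. f (\<chi> j. if j = i then - (x $ j) else x $ j) = f x) \<and>
    (\<forall>\<sigma> x. bij \<sigma> \<longrightarrow> f (\<chi> j. x $ \<sigma> j) = f x)"

text \<open>
  The susceptibility takes values in $[0,\infty]$; it is only used for nonnegative \<open>S\<close>, for which
  \<^const>\<open>ennreal\<close> does not truncate.
\<close>

definition suscept :: "(int ^ 'n \<Rightarrow> real) \<Rightarrow> real ^ 'n \<Rightarrow> ennreal"
  where "suscept S \<mu> = (\<Sum>\<^sub>\<infinity>x. ennreal (tilt \<mu> S x))"

definition Omega :: "(int ^ 'n \<Rightarrow> real) \<Rightarrow> (real ^ 'n) set"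
  where "Omega S = {\<mu>. suscept S \<mu> < \<infinity>}"

definition mass :: "'n \<Rightarrow> (int ^ 'n \<Rightarrow> real) \<Rightarrow> real"
  where "mass i S = Sup {t. 0 \<le> t \<and> suscept S (t *\<^sub>R axis i 1) < \<infinity>}"

definition assumption1 :: "'n \<Rightarrow> (int ^ 'n \<Rightarrow> real) \<Rightarrow> bool"
  where "assumption1 i S \<longleftrightarrow>
    Zd_symmetric S \<and> open (Omega S) \<and> 0 \<in> Omega S \<and>
    (\<exists>\<mu>\<^sub>1>0. \<mu>\<^sub>1 *\<^sub>R axis i 1 \<notin> Omega S)"

definition p_exponent :: "nat \<Rightarrow> real \<Rightarrow> real"
  where "p_exponent d \<zeta> = (if d = 1 then 2 else real d / (real d - 2 + min \<zeta> 2))"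

definition tilted_bounds ::
  "real \<Rightarrow> real \<Rightarrow> real \<Rightarrow> (int ^ 'n \<Rightarrow> real) \<Rightarrow> (int ^ 'n \<Rightarrow> real) \<Rightarrow> bool"
  where "tilted_bounds M K \<zeta> Q g \<longleftrightarrow>
    lp_norm_le 1 Q M \<and>
    lp_norm_le 1 (\<lambda>y. norm (emb y) powr (2 + \<zeta>) * Q y) M \<and>
    (\<forall>k. (\<forall>j. - pi \<le> k $ j \<and> k $ j \<le> pi) \<longrightarrow>
      Re (fourier Q 0 - fourier Q k) \<ge> K * (norm k)\<^sup>2) \<and>
    lp_norm_le 1 g M \<and>
    lp_norm_le 1 (\<lambda>y. norm (emb y) powr \<zeta> * g y) M \<and>
    lp_norm_le (min (p_exponent CARD('n) \<zeta>) 2) (\<lambda>y. (norm (emb y))\<^sup>2 * g y) M"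

text \<open>
  The Fourier transform of a real function at \<open>0\<close> is real, so positivity of $\hat h^{(\mu)}(0)$
  is expressed through \<^const>\<open>Re\<close>.
\<close>

definition weak_assumption2 ::
  "real \<Rightarrow> real \<Rightarrow> real \<Rightarrow> (int ^ 'n \<Rightarrow> real) \<Rightarrow> (int ^ 'n \<Rightarrow> real) \<Rightarrow> (int ^ 'n \<Rightarrow> real) \<Rightarrow> bool"
  where "weak_assumption2 M K \<zeta> S J h \<longleftrightarrow>
    Zd_symmetric J \<and> Zd_symmetric h \<and> in_lp 1 J \<and> in_lp 1 h \<and>
    (\<forall>x. S x = h x + conv J S x) \<and>
    (\<forall>\<mu> \<in> closure (Omega S).
      Re (fourier (tilt \<mu> h) 0) > 0 \<and> tilted_bounds M K \<zeta> (tilt \<mu> J) (tilt \<mu> h))"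

definition strictly_convex :: "'a::real_normed_vector set \<Rightarrow> bool"
  where "strictly_convex A \<longleftrightarrow>
    (\<forall>a\<in>A. \<forall>b\<in>A. a \<noteq> b \<longrightarrow> open_segment a b \<subseteq> interior A)"

definition boundary_maximiser :: "(int ^ 'n \<Rightarrow> real) \<Rightarrow> real ^ 'n \<Rightarrow> real ^ 'n \<Rightarrow> bool"
  where "boundary_maximiser S x \<mu> \<longleftrightarrow>
    \<mu> \<in> frontier (Omega S) \<and> (\<forall>\<nu>\<in>closure (Omega S). \<nu> \<bullet> x \<le> \<mu> \<bullet> x)"

definition eta :: "(int ^ 'n \<Rightarrow> real) \<Rightarrow> real ^ 'n \<Rightarrow> real ^ 'n"
  where "eta J \<mu> = (\<chi> j. \<Sum>\<^sub>\<infinity>y. emb y $ j * tilt \<mu> J y)"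

definition Lambda :: "(int ^ 'n \<Rightarrow> real) \<Rightarrow> real ^ 'n \<Rightarrow> real ^ 'n ^ 'n"
  where "Lambda J \<mu> = (\<chi> j l. \<Sum>\<^sub>\<infinity>y. emb y $ j * emb y $ l * tilt \<mu> J y)"

end

theory Submission
  imports Defs
begin

text \<open>
  Write \<open>F \<mu>\<close> for the sum of \<open>J\<close> tilted by \<open>\<mu>\<close> and \<open>H \<mu>\<close> for that of \<open>h\<close>. Summing the tilted
  renewal equation gives \<open>\<chi> * (1 - F) = H\<close> with \<open>0 < H \<le> M\<close>, so \<open>F < 1\<close> on \<open>\<Omega>\<close>, while \<open>F = 1\<close> on
  the boundary because \<open>\<chi>\<close> diverges along the ray from \<open>0\<close> to a boundary point. The infrared bound
  at small \<open>k\<close> bounds the Hessian of \<open>F\<close> below by \<open>2 * K\<close>, and the second moment bounds it above. As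
  \<open>F\<close> is in general defined on the closure of \<open>\<Omega>\<close> only, both are used in the form of two-sided
  quadratic estimates for \<open>F b - F a - \<nabla>F a \<bullet> (b - a)\<close> with \<open>a\<close>, \<open>b\<close> in that closure. The lower
  estimate yields strict convexity, the upper one identifies the normal direction at a boundary
  maximiser with \<open>\<nabla>F\<close>, and comparing \<open>F\<close> on the boundary with \<open>F 0\<close> shows that all boundary points
  have norm of order \<open>m\<^sub>S\<close>.
\<close>

subsection \<open>Infinite sums and elementary inequalities\<close>

lemma has_sum_finite_sum:
  fixes f :: "'i \<Rightarrow> 'a \<Rightarrow> 'b::{topological_comm_monoid_add}"
  assumes "finite I" "\<And>i. i \<in> I \<Longrightarrow> (f i has_sum s i) A"
  shows "((\<lambda>x. \<Sum>i\<in>I. f i x) has_sum (\<Sum>i\<in>I. s i)) A"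
  using assms by (induction I rule: finite_induct) (auto intro: has_sum_add)

text \<open>The summable bound \<open>g\<close> makes the finite partial sums converge uniformly for
  \<open>t\<close> in \<open>T\<close> (Weierstrass M-test), so the limit over finite sets can be
  exchanged with the limit along \<open>F\<close>.\<close>

lemma infsum_dominated_convergence:
  fixes f :: "'a \<Rightarrow> 'b \<Rightarrow> real"
  assumes "g summable_on A" "F \<noteq> bot"
    and lim: "\<And>x. x \<in> A \<Longrightarrow> (f x \<longlongrightarrow> l x) F"
    and dom: "\<And>x t. x \<in> A \<Longrightarrow> t \<in> T \<Longrightarrow> \<bar>f x t\<bar> \<le> g x"
    and ev: "eventually (\<lambda>t. t \<in> T) F"
  shows "((\<lambda>t. \<Sum>\<^sub>\<infinity>x\<in>A. f x t) \<longlongrightarrow> (\<Sum>\<^sub>\<infinity>x\<in>A. l x)) F"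
proof (rule swap_uniform_limit')
  have "\<bar>l x\<bar> \<le> g x" if "x \<in> A" for x
    using tendsto_upperbound[OF tendsto_rabs[OF lim[OF that]]] dom[OF that] ev assms(2)
    by (metis (mono_tags, lifting) eventually_mono)
  then have "(\<lambda>x. norm (l x)) summable_on A"
    by (intro Infinite_Sum.abs_summable_on_comparison_test'[OF assms(1)]) simp
  then have "l summable_on A"
    by (rule abs_summable_summable)
  then show "(sum l \<longlongrightarrow> infsum l A) (finite_subsets_at_top A)"
    by (rule infsum_tendsto)
  show "\<forall>\<^sub>F X in finite_subsets_at_top A. ((\<lambda>t. \<Sum>x\<in>X. f x t) \<longlongrightarrow> sum l X) F"
    by (rule eventually_finite_subsets_at_top_weakI) (auto intro!: tendsto_sum lim)
  show "uniform_limit T (\<lambda>X t. \<Sum>x\<in>X. f x t) (\<lambda>t. \<Sum>\<^sub>\<infinity>x\<in>A. f x t) (finite_subsets_at_top A)"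
    by (rule Weierstrass_m_test_general) (use dom assms(1) in auto)
qed (use assms(2) ev in auto)

text \<open>Both sides are tails outside \<open>B\<close>. This form controls the error of
  truncating a series by the tail of a fixed dominating series.\<close>

lemma infsum_diff_sum_le:
  fixes f g :: "'a \<Rightarrow> real"
  assumes "f summable_on A" "g summable_on A" "\<And>x. x \<in> A \<Longrightarrow> f x \<le> g x" "finite B" "B \<subseteq> A"
  shows "infsum f A - sum f B \<le> infsum g A - sum g B"
proof -
  have s: "(\<lambda>x. g x + - f x) summable_on A"
    by (intro summable_on_add summable_on_uminus[THEN iffD2] assms)
  have "sum (\<lambda>x. g x + - f x) B \<le> (\<Sum>\<^sub>\<infinity>x\<in>A. g x + - f x)"
    by (rule finite_sum_le_infsum[OF s]) (use assms in auto)
  also have "\<dots> = infsum g A - infsum f A"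
    using assms by (subst infsum_add) (auto simp: summable_on_uminus infsum_uminus)
  finally show ?thesis by (simp add: sum_subtractf sum_negf sum.distrib)
qed

text \<open>The factor \<open>1 + exp t\<close> is chosen for tilts: at
  \<open>t = (b - a) \<bullet> emb y\<close> it turns the absolute tilt at \<open>a\<close> into the
  sum of the absolute tilts at \<open>a\<close> and \<open>b\<close>, and both have bounded second
  moments.\<close>

lemma exp_taylor2_bounds:
  fixes t :: real
  shows "0 \<le> exp t - 1 - t" "exp t - 1 - t \<le> t\<^sup>2 * (1 + exp t)"
proof -
  show "0 \<le> exp t - 1 - t" using exp_ge_add_one_self[of t] by linarith
  have "1 - t \<le> exp (- t)" using exp_ge_add_one_self[of "-t"] by simp
  then have "(1 - t) * exp t \<le> exp (- t) * exp t" by (rule mult_right_mono) simp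
  then have le: "exp t - 1 \<le> t * exp t" by (simp add: algebra_simps flip: exp_add)
  show "exp t - 1 - t \<le> t\<^sup>2 * (1 + exp t)"
  proof (cases "t \<ge> 0")
    case True
    have "exp t - 1 - t \<le> t * (exp t - 1)" using le by (simp add: algebra_simps)
    also have "\<dots> \<le> t * (t * exp t)" using le True by (intro mult_left_mono)
    also have "\<dots> \<le> t\<^sup>2 * (1 + exp t)" by (simp add: power2_eq_square algebra_simps)
    finally show ?thesis .
  next
    case False
    have "exp t - 1 - t \<le> t * (exp t - 1)" using le by (simp add: algebra_simps)
    also have "\<dots> \<le> t * t"
      using False exp_ge_add_one_self[of t] by (intro mult_left_mono_neg) linarith+
    also have "\<dots> \<le> t\<^sup>2 * (1 + exp t)" using mult_left_mono[of 1 "1 + exp t" "t * t"] by (simp add: power2_eq_square)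
    finally show ?thesis .
  qed
qed

lemma abs_exp_minus_one_le:
  fixes t :: real
  shows "\<bar>exp t - 1\<bar> \<le> \<bar>t\<bar> * (1 + exp t)"
proof -
  have "1 - t \<le> exp (- t)" using exp_ge_add_one_self[of "-t"] by simp
  then have "(1 - t) * exp t \<le> exp (- t) * exp t" by (rule mult_right_mono) simp
  then have le: "exp t - 1 \<le> t * exp t" by (simp add: algebra_simps flip: exp_add)
  show ?thesis
  proof (cases "t \<ge> 0")
    case True then show ?thesis using le by (simp add: algebra_simps)
  next
    case False
    then have "\<bar>exp t - 1\<bar> = 1 - exp t" by simp
    also have "\<dots> \<le> \<bar>t\<bar> * 1" using False exp_ge_add_one_self[of t] by linarith
    also have "\<dots> \<le> \<bar>t\<bar> * (1 + exp t)" by (rule mult_left_mono) auto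
    finally show ?thesis .
  qed
qed

text \<open>The interpolated exponent is at most the larger of \<open>p\<close> and
  \<open>q\<close>. Hence all tilts along a segment are dominated, uniformly in \<open>t\<close>, by
  the tilts at its end points.\<close>

lemma exp_interpolate_le:
  fixes p q t :: real
  assumes "0 \<le> t" "t \<le> 1"
  shows "exp ((1 - t) * p + t * q) \<le> exp p + exp q"
proof -
  have "(1 - t) * p + t * q \<le> max p q"
    using assms by (intro convex_bound_le) auto
  then have "exp ((1 - t) * p + t * q) \<le> exp (max p q)" by simp
  also have "\<dots> \<le> exp p + exp q" by (simp add: max_def)
  finally show ?thesis .
qed

lemma summable_on_real_comparison:
  fixes f g :: "'a \<Rightarrow> real"
  assumes "g summable_on A" "\<And>x. x \<in> A \<Longrightarrow> \<bar>f x\<bar> \<le> g x"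
  shows "f summable_on A"
  by (rule abs_summable_summable, rule Infinite_Sum.abs_summable_on_comparison_test'[OF assms(1)]) (use assms(2) in simp)

lemma lp_norm_le_1_iff:
  "lp_norm_le 1 f B \<longleftrightarrow> (\<lambda>y. \<bar>f y\<bar>) summable_on UNIV \<and> (\<Sum>\<^sub>\<infinity>y. \<bar>f y\<bar>) \<le> B"
proof -
  have "(\<Sum>\<^sub>\<infinity>y. \<bar>f y\<bar>) \<ge> 0" by (rule infsum_nonneg) simp
  then show ?thesis by (simp add: lp_norm_le_def lp_norm_def in_lp_def)
qed

text \<open>Since no lattice point has norm strictly between \<open>0\<close> and \<open>1\<close>,
  powers of the norm increase with the exponent, and the moment of order \<open>2 + \<zeta>\<close>
  controls the second moment.\<close>

lemma norm_emb_ge_1: "emb y = 0 \<or> 1 \<le> norm (emb y)"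
proof (rule disjCI)
  assume "\<not> 1 \<le> norm (emb y)"
  then have "\<bar>emb y $ j\<bar> < 1" for j
    using component_le_norm_cart[of "emb y" j] by linarith
  then have "\<bar>y $ j\<bar> < 1" for j
    by (metis emb_def of_int_abs of_int_less_1_iff vec_lambda_beta)
  then show "emb y = 0" by (simp add: emb_def vec_eq_iff)
qed

lemma one_minus_cos_le: "1 - cos t \<le> t\<^sup>2" for t :: real
proof -
  have "1 - cos t = 2 * (sin (t / 2))\<^sup>2"
    using cos_double_sin[of "t/2"] by simp
  also have "\<dots> \<le> 2 * (t/2)\<^sup>2"
    using abs_sin_x_le_abs_x[of "t/2"] by (intro mult_left_mono) (simp_all only: abs_le_square_iff)
  also have "\<dots> \<le> t\<^sup>2" by (simp add: power2_eq_square)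
  finally show ?thesis .
qed

text \<open>The half-angle formula reduces the limit to the derivative of sine at
  \<open>0\<close>.\<close>

lemma cos_second_difference_limit:
  "((\<lambda>s. (1 - cos (s * t)) / s\<^sup>2) \<longlongrightarrow> t\<^sup>2 / 2) (at_right (0::real))" for t :: real
proof -
  have "((\<lambda>s. sin (t/2 * s)) has_real_derivative t/2) (at 0 within {0<..})"
    by (auto intro!: derivative_eq_intros)
  then have "((\<lambda>s. sin (t/2 * s) / s) \<longlongrightarrow> t/2) (at_right 0)"
    by (simp add: has_field_derivative_iff)
  then have "((\<lambda>s. 2 * (sin (t/2 * s) / s)\<^sup>2) \<longlongrightarrow> 2 * (t/2)\<^sup>2) (at_right 0)"
    by (intro tendsto_mult tendsto_power tendsto_const)
  moreover have "(\<lambda>s. 2 * (sin (t/2 * s) / s)\<^sup>2) = (\<lambda>s. (1 - cos (s * t)) / s\<^sup>2)"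
    using cos_double_sin[of "t/2 * s" for s] by (simp add: power_divide mult.commute)
  moreover have "2 * (t/2)\<^sup>2 = t\<^sup>2 / 2" by (simp add: power2_eq_square)
  ultimately show ?thesis by simp
qed

subsection \<open>The infrared bound as a Hessian bound\<close>

text \<open>The quadratic form of the second moment matrix. For \<open>Q = tilt \<mu> J\<close> it
  is the form of \<open>Lambda J \<mu>\<close>, formally the second derivative of the tilted sum in
  direction \<open>k\<close>.\<close>

definition quad :: "real ^ 'n \<Rightarrow> (int ^ 'n \<Rightarrow> real) \<Rightarrow> real"
  where "quad k Q = (\<Sum>\<^sub>\<infinity>y. (k \<bullet> emb y)\<^sup>2 * Q y)"

text \<open>
  The part of the hypotheses on a tilt \<open>Q\<close> of \<open>J\<close> that the argument uses. The bound on \<open>quad\<close> is the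
  infrared bound expanded to second order at \<open>k = 0\<close>, which makes \<open>2 * K\<close> a lower bound for the
  Hessian of the tilted sum.
\<close>

definition regular :: "real \<Rightarrow> real \<Rightarrow> (int ^ 'n \<Rightarrow> real) \<Rightarrow> bool"
  where "regular M K Q \<longleftrightarrow>
    (\<lambda>y. \<bar>Q y\<bar>) summable_on UNIV \<and> (\<Sum>\<^sub>\<infinity>y. \<bar>Q y\<bar>) \<le> M \<and>
    (\<lambda>y. (norm (emb y))\<^sup>2 * \<bar>Q y\<bar>) summable_on UNIV \<and>
    (\<Sum>\<^sub>\<infinity>y. (norm (emb y))\<^sup>2 * \<bar>Q y\<bar>) \<le> M \<and>
    (\<forall>k. 2 * K * (norm k)\<^sup>2 \<le> quad k Q)"

lemma second_moment_inner:
  assumes "(\<lambda>y. (norm (emb y))\<^sup>2 * \<bar>Q y\<bar>) summable_on UNIV"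
  shows "(\<lambda>y. (k \<bullet> emb y)\<^sup>2 * \<bar>Q y\<bar>) summable_on UNIV"
    "(\<Sum>\<^sub>\<infinity>y. (k \<bullet> emb y)\<^sup>2 * \<bar>Q y\<bar>) \<le> (norm k)\<^sup>2 * (\<Sum>\<^sub>\<infinity>y. (norm (emb y))\<^sup>2 * \<bar>Q y\<bar>)"
proof -
  let ?B = "\<lambda>y. (norm k)\<^sup>2 * ((norm (emb y))\<^sup>2 * \<bar>Q y\<bar>)"
  have B: "?B summable_on UNIV"
    by (rule summable_on_cmult_right[OF assms])
  have "(k \<bullet> emb y)\<^sup>2 \<le> (norm k * norm (emb y))\<^sup>2" for y
    using Cauchy_Schwarz_ineq2[of k "emb y"] by (metis abs_ge_zero power2_abs power_mono)
  then have le: "(k \<bullet> emb y)\<^sup>2 * \<bar>Q y\<bar> \<le> ?B y" for y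
    by (simp add: mult_right_mono power_mult_distrib flip: mult.assoc)
  show *: "(\<lambda>y. (k \<bullet> emb y)\<^sup>2 * \<bar>Q y\<bar>) summable_on UNIV"
    by (rule summable_on_real_comparison[OF B]) (use le in \<open>simp add: abs_mult\<close>)
  show "(\<Sum>\<^sub>\<infinity>y. (k \<bullet> emb y)\<^sup>2 * \<bar>Q y\<bar>) \<le> (norm k)\<^sup>2 * (\<Sum>\<^sub>\<infinity>y. (norm (emb y))\<^sup>2 * \<bar>Q y\<bar>)"
    using infsum_mono[OF * B le] by (simp only: infsum_cmult_right')
qed

lemma regular_inner:
  assumes "regular M K Q"
  shows "(\<lambda>y. (k \<bullet> emb y)\<^sup>2 * \<bar>Q y\<bar>) summable_on UNIV"
    "(\<lambda>y. (k \<bullet> emb y)\<^sup>2 * Q y) summable_on UNIV"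
    "(\<Sum>\<^sub>\<infinity>y. (k \<bullet> emb y)\<^sup>2 * \<bar>Q y\<bar>) \<le> M * (norm k)\<^sup>2"
    "(\<lambda>y. Q y) summable_on UNIV"
    "(\<lambda>y. \<bar>k \<bullet> emb y\<bar> * \<bar>Q y\<bar>) summable_on UNIV"
    "(\<lambda>y. (k \<bullet> emb y) * Q y) summable_on UNIV"
proof -
  have s2: "(\<lambda>y. (norm (emb y))\<^sup>2 * \<bar>Q y\<bar>) summable_on UNIV"
    and M: "(\<Sum>\<^sub>\<infinity>y. (norm (emb y))\<^sup>2 * \<bar>Q y\<bar>) \<le> M"
    using assms by (auto simp: regular_def)
  show *: "(\<lambda>y. (k \<bullet> emb y)\<^sup>2 * \<bar>Q y\<bar>) summable_on UNIV"
    by (rule second_moment_inner[OF s2])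
  show "(\<lambda>y. (k \<bullet> emb y)\<^sup>2 * Q y) summable_on UNIV"
    by (rule summable_on_real_comparison[OF *]) (simp add: abs_mult)
  show Q: "(\<lambda>y. Q y) summable_on UNIV"
    using assms summable_on_iff_abs_summable_on_real[of Q UNIV] by (simp add: regular_def)
  show "(\<Sum>\<^sub>\<infinity>y. (k \<bullet> emb y)\<^sup>2 * \<bar>Q y\<bar>) \<le> M * (norm k)\<^sup>2"
    using second_moment_inner(2)[OF s2, of k] mult_left_mono[OF M, of "(norm k)\<^sup>2"]
    by (simp add: mult.commute)
  have "(\<lambda>y. \<bar>Q y\<bar> + (k \<bullet> emb y)\<^sup>2 * \<bar>Q y\<bar>) summable_on UNIV"
    using assms * by (intro summable_on_add) (auto simp: regular_def)
  moreover have "\<bar>k \<bullet> emb y\<bar> * \<bar>Q y\<bar> \<le> \<bar>Q y\<bar> + (k \<bullet> emb y)\<^sup>2 * \<bar>Q y\<bar>" for y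
  proof -
    \<comment> \<open>The first moment is dominated by the zeroth and second ones.\<close>
    have "0 \<le> (\<bar>k \<bullet> emb y\<bar> - 1)\<^sup>2" by simp
    then have "\<bar>k \<bullet> emb y\<bar> \<le> 1 + (k \<bullet> emb y)\<^sup>2"
      using abs_ge_zero[of "k \<bullet> emb y"] by (simp add: power2_diff) 
    then have "\<bar>k \<bullet> emb y\<bar> * \<bar>Q y\<bar> \<le> (1 + (k \<bullet> emb y)\<^sup>2) * \<bar>Q y\<bar>" by (rule mult_right_mono) simp
    then show ?thesis by (simp add: algebra_simps)
  qed
  ultimately show **: "(\<lambda>y. \<bar>k \<bullet> emb y\<bar> * \<bar>Q y\<bar>) summable_on UNIV"
    by (elim summable_on_real_comparison) (simp add: abs_mult)
  show "(\<lambda>y. (k \<bullet> emb y) * Q y) summable_on UNIV"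
    by (rule summable_on_real_comparison[OF **]) (simp add: abs_mult)
qed

lemma Re_fourier:
  assumes "(\<lambda>y. \<bar>Q y\<bar>) summable_on UNIV"
  shows "Re (fourier Q k) = (\<Sum>\<^sub>\<infinity>y. Q y * cos (k \<bullet> emb y))"
proof -
  have "(\<lambda>y. of_real (Q y) * exp (- (\<i> * of_real (k \<bullet> emb y)))) summable_on UNIV"
    by (rule abs_summable_summable, rule Infinite_Sum.abs_summable_on_comparison_test'[OF assms])
      (simp add: norm_mult)
  then show ?thesis
    unfolding fourier_def by (subst infsum_Re[symmetric]) (auto simp: Re_exp)
qed

text \<open>The infrared bound at \<open>s *\<^sub>R k\<close> is divided by
  \<open>s\<^sup>2\<close> and \<open>s\<close> tends to \<open>0\<close> from the right. Dominated
  convergence gives half of \<open>quad k Q\<close> in the limit, which is where the factor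
  \<open>2\<close> in \<open>2 * K\<close> comes from.\<close>

lemma tilted_bounds_regular:
  assumes tb: "tilted_bounds M K \<zeta> Q g" and "\<zeta> > 0"
  shows "regular M K Q"
proof -
  have Q: "(\<lambda>y. \<bar>Q y\<bar>) summable_on UNIV" "(\<Sum>\<^sub>\<infinity>y. \<bar>Q y\<bar>) \<le> M"
    and Z: "(\<lambda>y. norm (emb y) powr (2 + \<zeta>) * \<bar>Q y\<bar>) summable_on UNIV"
      "(\<Sum>\<^sub>\<infinity>y. norm (emb y) powr (2 + \<zeta>) * \<bar>Q y\<bar>) \<le> M"
    and IR: "\<And>k. (\<forall>j. - pi \<le> k $ j \<and> k $ j \<le> pi) \<Longrightarrow>
      Re (fourier Q 0 - fourier Q k) \<ge> K * (norm k)\<^sup>2"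
    using tb by (auto simp: tilted_bounds_def lp_norm_le_1_iff abs_mult)
  have le: "(norm (emb y))\<^sup>2 * \<bar>Q y\<bar> \<le> norm (emb y) powr (2 + \<zeta>) * \<bar>Q y\<bar>" for y
    using norm_emb_ge_1[of y] \<open>\<zeta> > 0\<close>
    by (intro mult_right_mono) (auto simp: powr_mono simp flip: powr_numeral)
  have s2: "(\<lambda>y. (norm (emb y))\<^sup>2 * \<bar>Q y\<bar>) summable_on UNIV"
    by (rule summable_on_real_comparison[OF Z(1)]) (use le in \<open>simp add: abs_mult\<close>)
  have s2M: "(\<Sum>\<^sub>\<infinity>y. (norm (emb y))\<^sup>2 * \<bar>Q y\<bar>) \<le> M"
    using infsum_mono[OF s2 Z(1) le] Z(2) by linarith
  have "2 * K * (norm k)\<^sup>2 \<le> quad k Q" for k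
  proof -
    have sQ: "Q summable_on UNIV"
      using Q(1) summable_on_iff_abs_summable_on_real[of Q UNIV] by simp
    have sk: "(\<lambda>y. (k \<bullet> emb y)\<^sup>2 * \<bar>Q y\<bar>) summable_on UNIV"
      by (rule second_moment_inner[OF s2])
    have "((\<lambda>s. \<Sum>\<^sub>\<infinity>y. (1 - cos (s * (k \<bullet> emb y))) / s\<^sup>2 * Q y) \<longlongrightarrow>
        (\<Sum>\<^sub>\<infinity>y. (k \<bullet> emb y)\<^sup>2 / 2 * Q y)) (at_right 0)"
    proof (rule infsum_dominated_convergence[where T = "{0<..}", OF sk])
      show "\<bar>(1 - cos (s * (k \<bullet> emb y))) / s\<^sup>2 * Q y\<bar> \<le> (k \<bullet> emb y)\<^sup>2 * \<bar>Q y\<bar>"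
        if "s \<in> {0<..}" for s y
      proof -
        have "(1 - cos (s * (k \<bullet> emb y))) / s\<^sup>2 \<le> (k \<bullet> emb y)\<^sup>2"
          using that one_minus_cos_le[of "s * (k \<bullet> emb y)"] by (simp add: field_simps)
        then have "(1 - cos (s * (k \<bullet> emb y))) / s\<^sup>2 * \<bar>Q y\<bar> \<le> (k \<bullet> emb y)\<^sup>2 * \<bar>Q y\<bar>"
          by (rule mult_right_mono) simp
        then show ?thesis by (simp add: abs_mult)
      qed
    qed (auto simp: eventually_at_right_less simp del: times_divide_eq_left
        intro!: tendsto_mult_right cos_second_difference_limit)
    moreover have "\<forall>\<^sub>F s in at_right 0. K * (norm k)\<^sup>2 \<le>
        (\<Sum>\<^sub>\<infinity>y. (1 - cos (s * (k \<bullet> emb y))) / s\<^sup>2 * Q y)"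
    proof -
      \<comment> \<open>For \<open>s < b\<close> the point \<open>s *\<^sub>R k\<close> lies in the
        box where the infrared bound holds; the summand \<open>1\<close> keeps the denominator
        positive when \<open>k = 0\<close>.\<close>
      define b where "b = pi / (norm k + 1)"
      have "b > 0" by (simp add: b_def add_nonneg_pos)
      have *: "K * (norm k)\<^sup>2 \<le> (\<Sum>\<^sub>\<infinity>y. (1 - cos (s * (k \<bullet> emb y))) / s\<^sup>2 * Q y)"
        if s: "0 < s" "s < b" for s
      proof -
        have "s * norm k \<le> s * (norm k + 1)" using s by simp
        also have "\<dots> \<le> b * (norm k + 1)" using s by (intro mult_right_mono) auto
        also have "\<dots> = pi" using add_nonneg_pos[OF norm_ge_zero[of k] zero_less_one] by (simp add: b_def)
        finally have "\<bar>(s *\<^sub>R k) $ j\<bar> \<le> pi" for j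
          using component_le_norm_cart[of "s *\<^sub>R k" j] s by simp
        then have "K * (norm (s *\<^sub>R k))\<^sup>2 \<le> Re (fourier Q 0 - fourier Q (s *\<^sub>R k))"
          by (intro IR) (metis abs_le_D1 abs_le_D2 minus_le_iff)
        also have "\<dots> = (\<Sum>\<^sub>\<infinity>y. Q y + - (Q y * cos (s * (k \<bullet> emb y))))"
        proof -
          have "(\<lambda>y. Q y * cos (s * (k \<bullet> emb y))) summable_on UNIV"
            by (rule summable_on_real_comparison[OF Q(1)]) (simp add: abs_mult mult_left_le)
          then show ?thesis
            by (subst infsum_add)
              (auto simp: sQ summable_on_uminus infsum_uminus Re_fourier[OF Q(1)])
        qed
        also have "\<dots> = (\<Sum>\<^sub>\<infinity>y. s\<^sup>2 * ((1 - cos (s * (k \<bullet> emb y))) / s\<^sup>2 * Q y))"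
          using s by (intro infsum_cong) (simp add: field_simps)
        also have "\<dots> = s\<^sup>2 * (\<Sum>\<^sub>\<infinity>y. (1 - cos (s * (k \<bullet> emb y))) / s\<^sup>2 * Q y)"
          by (rule infsum_cmult_right')
        finally have "s\<^sup>2 * (K * (norm k)\<^sup>2) \<le> s\<^sup>2 * (\<Sum>\<^sub>\<infinity>y. (1 - cos (s * (k \<bullet> emb y))) / s\<^sup>2 * Q y)"
          by (simp add: power_mult_distrib ac_simps)
        then show ?thesis using s by (simp add: mult_le_cancel_left_pos)
      qed
      show ?thesis
        using \<open>b > 0\<close> * by (auto simp: eventually_at_right_field)
    qed
    ultimately have "K * (norm k)\<^sup>2 \<le> (\<Sum>\<^sub>\<infinity>y. (k \<bullet> emb y)\<^sup>2 / 2 * Q y)"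
      by (rule tendsto_lowerbound) simp
    also have "\<dots> = (\<Sum>\<^sub>\<infinity>y. (1/2) * ((k \<bullet> emb y)\<^sup>2 * Q y))" by simp
    also have "\<dots> = (1/2) * quad k Q" unfolding quad_def by (rule infsum_cmult_right')
    finally show ?thesis by simp
  qed
  then show ?thesis using Q s2 s2M by (simp add: regular_def)
qed

subsection \<open>Quadratic estimates for the tilted sum\<close>

text \<open>Formally \<open>eta J \<mu>\<close> is the gradient of the tilted sum at
  \<open>\<mu>\<close>, and this is its directional derivative.\<close>

lemma eta_inner:
  assumes "regular M K (tilt \<mu> J)"
  shows "k \<bullet> eta J \<mu> = (\<Sum>\<^sub>\<infinity>y. (k \<bullet> emb y) * tilt \<mu> J y)"
proof -
  have c: "((\<lambda>y. emb y $ j * tilt \<mu> J y) has_sum eta J \<mu> $ j) UNIV" for j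
    using regular_inner(6)[OF assms, of "axis j 1"] by (simp add: eta_def inner_axis')
  have "((\<lambda>y. \<Sum>j\<in>UNIV. k $ j * (emb y $ j * tilt \<mu> J y)) has_sum
      (\<Sum>j\<in>UNIV. k $ j * eta J \<mu> $ j)) UNIV"
    by (intro has_sum_finite_sum has_sum_cmult_right c) simp
  then have "((\<lambda>y. (k \<bullet> emb y) * tilt \<mu> J y) has_sum k \<bullet> eta J \<mu>) UNIV"
    by (simp add: inner_vec_def sum_distrib_right mult.assoc)
  then show ?thesis by (simp add: infsumI)
qed

lemma Lambda_inner:
  assumes "regular M K (tilt \<mu> J)"
  shows "k \<bullet> (Lambda J \<mu> *v k) = quad k (tilt \<mu> J)"
proof -
  have s2: "(\<lambda>y. (norm (emb y))\<^sup>2 * \<bar>tilt \<mu> J y\<bar>) summable_on UNIV"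
    using assms by (simp add: regular_def)
  have c: "((\<lambda>y. emb y $ j * emb y $ l * tilt \<mu> J y) has_sum Lambda J \<mu> $ j $ l) UNIV" for j l
  proof -
    have "\<bar>emb y $ j * emb y $ l * tilt \<mu> J y\<bar> \<le> (norm (emb y))\<^sup>2 * \<bar>tilt \<mu> J y\<bar>" for y
      unfolding power2_eq_square abs_mult
      by (intro mult_mono component_le_norm_cart) auto
    then have "(\<lambda>y. emb y $ j * emb y $ l * tilt \<mu> J y) summable_on UNIV"
      by (rule summable_on_real_comparison[OF s2])
    then show ?thesis by (simp add: Lambda_def)
  qed
  have "((\<lambda>y. \<Sum>j\<in>UNIV. k $ j * (\<Sum>l\<in>UNIV. k $ l * (emb y $ j * emb y $ l * tilt \<mu> J y))) has_sum
      (\<Sum>j\<in>UNIV. k $ j * (\<Sum>l\<in>UNIV. k $ l * Lambda J \<mu> $ j $ l))) UNIV"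
    by (intro has_sum_finite_sum has_sum_cmult_right c) simp_all
  moreover have "(\<Sum>j\<in>UNIV. k $ j * (\<Sum>l\<in>UNIV. k $ l * (emb y $ j * emb y $ l * tilt \<mu> J y))) =
      (k \<bullet> emb y)\<^sup>2 * tilt \<mu> J y" for y
    by (simp add: inner_vec_def power2_eq_square sum_product sum_distrib_left sum_distrib_right ac_simps)
  moreover have "(\<Sum>j\<in>UNIV. k $ j * (\<Sum>l\<in>UNIV. k $ l * Lambda J \<mu> $ j $ l)) = k \<bullet> (Lambda J \<mu> *v k)"
    by (simp add: inner_vec_def matrix_vector_mult_def mult.commute)
  ultimately show ?thesis by (simp add: quad_def infsumI)
qed

lemma quad_le:
  assumes "regular M K Q"
  shows "quad k Q \<le> M * (norm k)\<^sup>2"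
proof -
  have "quad k Q \<le> (\<Sum>\<^sub>\<infinity>y. (k \<bullet> emb y)\<^sup>2 * \<bar>Q y\<bar>)"
    unfolding quad_def using regular_inner[OF assms] by (intro infsum_mono) (auto intro: mult_left_mono)
  then show ?thesis using regular_inner(3)[OF assms, of k] by linarith
qed

lemma tilt_add: "tilt (a + w) J y = tilt a J y * exp (w \<bullet> emb y)"
  by (simp add: tilt_def inner_add_left exp_add)

lemma abs_tilt_interpolate_le:
  assumes "0 \<le> t" "t \<le> 1"
  shows "\<bar>tilt ((1 - t) *\<^sub>R a + t *\<^sub>R b) J y\<bar> \<le> \<bar>tilt a J y\<bar> + \<bar>tilt b J y\<bar>"
  using mult_left_mono[OF exp_interpolate_le[OF assms, of "a \<bullet> emb y" "b \<bullet> emb y"], of "\<bar>J y\<bar>"]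
  by (simp add: tilt_def abs_mult inner_add_left algebra_simps)

definition tilt_sum :: "(int ^ 'n \<Rightarrow> real) \<Rightarrow> real ^ 'n \<Rightarrow> real"
  where "tilt_sum J \<mu> = (\<Sum>\<^sub>\<infinity>y. tilt \<mu> J y)"

text \<open>Writing the first-order remainder as a single series allows termwise estimates through
  \<open>exp t - 1 - t\<close>, without differentiating the infinite sum.\<close>

lemma taylor_remainder_has_sum:
  assumes a: "regular M K (tilt a J)" and b: "regular M K (tilt b J)"
  shows "((\<lambda>y. tilt a J y * (exp ((b - a) \<bullet> emb y) - 1 - (b - a) \<bullet> emb y)) has_sum
      (tilt_sum J b - tilt_sum J a - eta J a \<bullet> (b - a))) UNIV"
proof -
  have "((\<lambda>y. tilt b J y + - tilt a J y + - (((b - a) \<bullet> emb y) * tilt a J y)) has_sum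
      (tilt_sum J b + - tilt_sum J a + - ((b - a) \<bullet> eta J a))) UNIV"
    unfolding tilt_sum_def eta_inner[OF a]
    by (intro has_sum_add has_sum_uminus[THEN iffD2]) (use regular_inner[OF a] regular_inner[OF b] in auto)
  moreover have "tilt b J y = tilt a J y * exp ((b - a) \<bullet> emb y)" for y
    using tilt_add[of a "b - a"] by simp
  ultimately show ?thesis by (simp add: algebra_simps inner_commute)
qed

lemma second_moment_sum:
  assumes a: "regular M K (tilt a J)" and b: "regular M K (tilt b J)"
  shows "(\<lambda>y. (k \<bullet> emb y)\<^sup>2 * (\<bar>tilt a J y\<bar> + \<bar>tilt b J y\<bar>)) summable_on UNIV"
    "(\<Sum>\<^sub>\<infinity>y. (k \<bullet> emb y)\<^sup>2 * (\<bar>tilt a J y\<bar> + \<bar>tilt b J y\<bar>)) \<le> 2 * M * (norm k)\<^sup>2"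
  unfolding distrib_left
  using regular_inner(1,3)[OF a, of k] regular_inner(1,3)[OF b, of k]
  by (auto simp: infsum_add intro: summable_on_add)

text \<open>Each remainder term is bounded by the second moment terms at both end points; each end
  point contributes one \<open>M\<close>.\<close>

lemma taylor_upper:
  assumes a: "regular M K (tilt a J)" and b: "regular M K (tilt b J)"
  shows "tilt_sum J b \<le> tilt_sum J a + eta J a \<bullet> (b - a) + 2 * M * (norm (b - a))\<^sup>2"
proof -
  let ?w = "b - a"
  have "tilt a J y * (exp (?w \<bullet> emb y) - 1 - ?w \<bullet> emb y)
      \<le> (?w \<bullet> emb y)\<^sup>2 * (\<bar>tilt a J y\<bar> + \<bar>tilt b J y\<bar>)" for y
  proof -
    have "tilt a J y * (exp (?w \<bullet> emb y) - 1 - ?w \<bullet> emb y)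
        \<le> \<bar>tilt a J y\<bar> * ((?w \<bullet> emb y)\<^sup>2 * (1 + exp (?w \<bullet> emb y)))"
      using exp_taylor2_bounds[of "?w \<bullet> emb y"] by (intro mult_mono) auto
    moreover have "\<bar>tilt b J y\<bar> = \<bar>tilt a J y\<bar> * exp (?w \<bullet> emb y)"
      using tilt_add[of a "b - a" J y] by (simp add: abs_mult)
    ultimately show ?thesis by (simp add: algebra_simps)
  qed
  then have "tilt_sum J b - tilt_sum J a - eta J a \<bullet> ?w
      \<le> (\<Sum>\<^sub>\<infinity>y. (?w \<bullet> emb y)\<^sup>2 * (\<bar>tilt a J y\<bar> + \<bar>tilt b J y\<bar>))"
    by (rule has_sum_mono[OF taylor_remainder_has_sum[OF a b]
          has_sum_infsum[OF second_moment_sum(1)[OF a b]]])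
  then show ?thesis using second_moment_sum(2)[OF a b, of ?w] by linarith
qed

text \<open>
  Taylor's formula is applied to finite partial sums only; \<open>B\<close> dominates the second derivative
  terms uniformly along the segment, so the truncation error vanishes in the limit.
\<close>

lemma taylor_lower:
  assumes reg: "\<And>t. 0 \<le> t \<Longrightarrow> t \<le> 1 \<Longrightarrow> regular M K (tilt ((1 - t) *\<^sub>R a + t *\<^sub>R b) J)"
  shows "tilt_sum J a + eta J a \<bullet> (b - a) + K * (norm (b - a))\<^sup>2 \<le> tilt_sum J b"
proof -
  have a: "regular M K (tilt a J)" and b: "regular M K (tilt b J)"
    using reg[of 0] reg[of 1] by auto
  define w where "w = b - a"
  let ?th = "\<lambda>y. w \<bullet> emb y"
  define B where "B = (\<lambda>y. (?th y)\<^sup>2 * (\<bar>tilt a J y\<bar> + \<bar>tilt b J y\<bar>))"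
  have B: "B summable_on UNIV" unfolding B_def by (rule second_moment_sum(1)[OF a b])
  have fin: "K * (norm w)\<^sup>2 - (infsum B UNIV - sum B A) / 2
      \<le> (\<Sum>y\<in>A. tilt a J y * (exp (?th y) - 1 - ?th y))" if "finite A" for A
  proof -
    \<comment> \<open>\<open>G m\<close> is the \<open>m\<close>-th derivative of
      \<open>G 0\<close>, the partial sum over \<open>A\<close> of the tilts at
      \<open>a + t *\<^sub>R w\<close>.\<close>
    define G where "G = (\<lambda>m t. \<Sum>y\<in>A. tilt a J y * ?th y ^ m * exp (t * ?th y))"
    have "\<exists>t::real. 0 < t \<and> t < 1 \<and>
        G 0 1 = (\<Sum>m<2. (G m 0 / fact m) * (1 - 0)^m) + (G 2 t / fact 2) * (1 - 0)^2"
    proof (rule Taylor_up[where a = 0])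
      show "\<forall>m t. m < 2 \<and> 0 \<le> t \<and> t \<le> 1 \<longrightarrow> DERIV (G m) t :> G (Suc m) t"
        unfolding G_def by (auto intro!: derivative_eq_intros sum.cong simp: ac_simps)
    qed auto
    then obtain t where t: "0 < t" "t < 1" and G: "G 0 1 = G 0 0 + G 1 0 + G 2 t / 2"
      by (auto simp: numeral_2_eq_2)
    let ?c = "(1 - t) *\<^sub>R a + t *\<^sub>R b"
    have c: "regular M K (tilt ?c J)" using reg t by simp
    have ct: "tilt ?c J y = tilt a J y * exp (t * ?th y)" for y
    proof -
      have "?c = a + t *\<^sub>R w" by (simp add: w_def algebra_simps)
      then show ?thesis by (simp add: tilt_add)
    qed
    have G2: "G 2 t = (\<Sum>y\<in>A. (?th y)\<^sup>2 * tilt ?c J y)"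
      unfolding G_def ct by (simp add: ac_simps)
    \<comment> \<open>As \<open>J\<close> may change sign, truncating \<open>quad\<close> to
      \<open>A\<close> may lower or raise it. The loss is at most the tail of \<open>B\<close>,
      which does not depend on the intermediate point.\<close>
    have d: "quad w (tilt ?c J) - G 2 t \<le> infsum B UNIV - sum B A"
      unfolding quad_def G2
    proof (rule infsum_diff_sum_le)
      show "(?th y)\<^sup>2 * tilt ?c J y \<le> B y" for y
        using abs_tilt_interpolate_le[of t a b J y] t unfolding B_def by (intro mult_left_mono) auto
    qed (use regular_inner(2)[OF c] B that in auto)
    have "2 * (K * (norm w)\<^sup>2) \<le> quad w (tilt ?c J)"
      using c by (simp add: regular_def mult.assoc)
    then have "K * (norm w)\<^sup>2 - (infsum B UNIV - sum B A) / 2 \<le> G 2 t / 2"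
      using d by (simp add: field_simps)
    also have "\<dots> = G 0 1 - G 0 0 - G 1 0" using G by linarith
    also have "\<dots> = (\<Sum>y\<in>A. tilt a J y * (exp (?th y) - 1 - ?th y))"
      unfolding G_def by (simp add: algebra_simps sum.distrib sum_subtractf)
    finally show ?thesis .
  qed
  have "((\<lambda>A. K * (norm w)\<^sup>2 - (infsum B UNIV - sum B A) / 2) \<longlongrightarrow>
      K * (norm w)\<^sup>2 - (infsum B UNIV - infsum B UNIV) / 2) (finite_subsets_at_top UNIV)"
    by (intro tendsto_intros infsum_tendsto B) simp
  moreover have "((\<lambda>A. \<Sum>y\<in>A. tilt a J y * (exp (?th y) - 1 - ?th y)) \<longlongrightarrow>
      tilt_sum J b - tilt_sum J a - eta J a \<bullet> w) (finite_subsets_at_top UNIV)"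
    using taylor_remainder_has_sum[OF a b] by (simp add: has_sum_def w_def)
  moreover have "\<forall>\<^sub>F A in finite_subsets_at_top UNIV. K * (norm w)\<^sup>2 - (infsum B UNIV - sum B A) / 2
      \<le> (\<Sum>y\<in>A. tilt a J y * (exp (?th y) - 1 - ?th y))"
    by (rule eventually_finite_subsets_at_top_weakI) (use fin in auto)
  ultimately have "K * (norm w)\<^sup>2 - (infsum B UNIV - infsum B UNIV) / 2
      \<le> tilt_sum J b - tilt_sum J a - eta J a \<bullet> w"
    using tendsto_le[OF finite_subsets_at_top_neq_bot] by blast
  then show ?thesis by (simp add: w_def)
qed

subsection \<open>Consequences of lattice symmetry\<close>

lemma emb_uminus: "emb (- y) = - emb y"
  by (simp add: emb_def vec_eq_iff)

lemma infsum_uminus_reindex: "(\<Sum>\<^sub>\<infinity>y::int ^ 'n. f (- y)) = (\<Sum>\<^sub>\<infinity>y. f y)"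
  by (rule infsum_reindex_bij_betw) (rule bij_uminus)

lemma summable_on_uminus_reindex:
  "(\<lambda>y::int ^ 'n. f (- y)) summable_on UNIV \<longleftrightarrow> f summable_on UNIV"
  by (rule summable_on_reindex_bij_betw) (rule bij_uminus)

text \<open>Reflecting \<open>y\<close> to \<open>- y\<close> turns the sum into its own negative;
  for a family that is not summable \<open>infsum\<close> is \<open>0\<close> anyway.\<close>

lemma first_moment_even:
  fixes f :: "int ^ 'n \<Rightarrow> real"
  assumes "\<And>y. f (- y) = f y"
  shows "(\<Sum>\<^sub>\<infinity>y. (k \<bullet> emb y) * f y) = 0"
proof -
  have "(\<Sum>\<^sub>\<infinity>y. (k \<bullet> emb y) * f y) = (\<Sum>\<^sub>\<infinity>y. - ((k \<bullet> emb y) * f y))"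
    using infsum_uminus_reindex[of "\<lambda>y. (k \<bullet> emb y) * f y"] by (simp add: emb_uminus assms)
  then show ?thesis by (simp add: infsum_uminus)
qed

text \<open>Coordinates are reflected one at a time, by induction on the set of reflected
  coordinates.\<close>

lemma Zd_symmetric_uminus:
  assumes "Zd_symmetric f"
  shows "f (- x) = f x"
proof -
  have flip: "f (\<chi> j. if j = i then - (x $ j) else x $ j) = f x" for i x
    using assms by (simp add: Zd_symmetric_def)
  have "f (\<chi> j. if j \<in> A then - (x $ j) else x $ j) = f x" if "finite A" for A :: "'a set"
    using that
  proof (induction A rule: finite_induct)
    case (insert a A)
    let ?x = "\<chi> j. if j \<in> A then - (x $ j) else x $ j"
    have "(\<chi> j. if j \<in> insert a A then - (x $ j) else x $ j) =
        (\<chi> j. if j = a then - (?x $ j) else ?x $ j)"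
      using insert.hyps by (auto simp: vec_eq_iff)
    then show ?case using flip[of a ?x] insert.IH by simp
  qed simp
  from this[of UNIV] show ?thesis
    by (simp add: uminus_vec_def)
qed

lemma tilt_0 [simp]: "tilt 0 J = J"
  by (auto simp: tilt_def)

lemma eta_0:
  assumes "Zd_symmetric J" "regular M K J"
  shows "eta J 0 = 0"
proof -
  have "k \<bullet> eta J 0 = 0" for k
    using eta_inner[of M K 0 J k] assms first_moment_even[of J k] Zd_symmetric_uminus[of J]
    by simp
  from this[of "eta J 0"] show ?thesis by simp
qed

text \<open>Since \<open>exp t - 1 - t\<close> is nonnegative, \<open>J\<close> may be replaced by
  its absolute value in the remainder at \<open>0\<close>. That is again even, so the linear part
  vanishes and only the difference of the two absolute sums is left. This yields the sharp constant
  in the bound \<open>M / K\<close>, which \<open>taylor_upper\<close> would not give.\<close>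

lemma tilt_sum_growth_le:
  assumes sym: "Zd_symmetric J" and 0: "regular M K J" and a: "regular M K (tilt a J)"
  shows "tilt_sum J a - tilt_sum J 0 \<le> M"
proof -
  let ?th = "\<lambda>y. a \<bullet> emb y"
  have s: "((\<lambda>y. J y * (exp (?th y) - 1 - ?th y)) has_sum (tilt_sum J a - tilt_sum J 0)) UNIV"
    using taylor_remainder_has_sum[of M K 0 J a] 0 a eta_0[OF sym 0] by simp
  have sa: "(\<lambda>y. \<bar>tilt a J y\<bar>) summable_on UNIV" and Ma: "(\<Sum>\<^sub>\<infinity>y. \<bar>tilt a J y\<bar>) \<le> M"
    using a by (auto simp: regular_def)
  have s0: "(\<lambda>y. \<bar>J y\<bar>) summable_on UNIV"
    using 0 by (auto simp: regular_def)
  have s1: "(\<lambda>y. ?th y * \<bar>J y\<bar>) summable_on UNIV"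
    by (rule summable_on_real_comparison[OF regular_inner(5)[OF 0, of a]]) (simp add: abs_mult)
  have "(\<Sum>\<^sub>\<infinity>y. ?th y * \<bar>J y\<bar>) = 0"
    by (rule first_moment_even) (simp add: Zd_symmetric_uminus[OF sym])
  then have "((\<lambda>y. \<bar>tilt a J y\<bar> + - (?th y * \<bar>J y\<bar>) + - \<bar>J y\<bar>) has_sum
      ((\<Sum>\<^sub>\<infinity>y. \<bar>tilt a J y\<bar>) + - 0 + - (\<Sum>\<^sub>\<infinity>y. \<bar>J y\<bar>))) UNIV"
    using sa s0 s1 by (intro has_sum_add has_sum_uminus[THEN iffD2]) (auto simp: has_sum_iff)
  then have "tilt_sum J a - tilt_sum J 0 \<le> (\<Sum>\<^sub>\<infinity>y. \<bar>tilt a J y\<bar>) + - 0 + - (\<Sum>\<^sub>\<infinity>y. \<bar>J y\<bar>)"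
  proof (rule has_sum_mono[OF s])
    fix y
    have "J y * (exp (?th y) - 1 - ?th y) \<le> \<bar>J y\<bar> * (exp (?th y) - 1 - ?th y)"
      using exp_taylor2_bounds(1)[of "?th y"] by (intro mult_right_mono) auto
    then show "J y * (exp (?th y) - 1 - ?th y) \<le> \<bar>tilt a J y\<bar> + - (?th y * \<bar>J y\<bar>) + - \<bar>J y\<bar>"
      by (simp add: tilt_def abs_mult algebra_simps)
  qed
  moreover have "0 \<le> (\<Sum>\<^sub>\<infinity>y. \<bar>J y\<bar>)" by (rule infsum_nonneg) simp
  ultimately show ?thesis using Ma by linarith
qed

text \<open>By symmetry \<open>eta J 0 = 0\<close>, so \<open>eta J a\<close> is a difference of
  gradients. Testing it against itself as \<open>u\<close>, with \<open>abs_exp_minus_one_le\<close>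
  in each term, leaves the second moments at \<open>0\<close> and \<open>a\<close>, each at most
  \<open>M\<close>.\<close>

lemma norm_eta_le:
  fixes a :: "real ^ 'n"
  assumes sym: "Zd_symmetric J" and 0: "regular M K J" and a: "regular M K (tilt a J)"
  shows "norm (eta J a) \<le> 2 * M * norm a"
proof -
  define u where "u = eta J a"
  let ?N = "\<lambda>y. (norm (emb y))\<^sup>2 * \<bar>J y\<bar> + (norm (emb y))\<^sup>2 * \<bar>tilt a J y\<bar>"
  have sN: "(?N has_sum ((\<Sum>\<^sub>\<infinity>y. (norm (emb y))\<^sup>2 * \<bar>J y\<bar>) + (\<Sum>\<^sub>\<infinity>y. (norm (emb y))\<^sup>2 * \<bar>tilt a J y\<bar>))) UNIV"
    using 0 a by (intro has_sum_add) (auto simp: regular_def)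
  have "((\<lambda>y. (u \<bullet> emb y) * tilt a J y + - ((u \<bullet> emb y) * J y)) has_sum (u \<bullet> eta J a + - (u \<bullet> eta J 0))) UNIV"
    using regular_inner(6)[OF a, of u] regular_inner(6)[OF 0, of u] eta_inner[of M K 0 J u] 0
    by (intro has_sum_add has_sum_uminus[THEN iffD2]) (auto simp: eta_inner[OF a])
  then have "norm (u \<bullet> eta J a + - (u \<bullet> eta J 0)) \<le> (norm u * norm a) *
    ((\<Sum>\<^sub>\<infinity>y. (norm (emb y))\<^sup>2 * \<bar>J y\<bar>) + (\<Sum>\<^sub>\<infinity>y. (norm (emb y))\<^sup>2 * \<bar>tilt a J y\<bar>))"
  proof (rule norm_infsum_le[OF _ has_sum_cmult_right[OF sN]])
    fix y :: "int ^ 'n"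
    let ?e = "emb y"
    have "\<bar>(u \<bullet> ?e) * (exp (a \<bullet> ?e) - 1)\<bar> \<le> (norm u * norm ?e) * ((norm a * norm ?e) * (1 + exp (a \<bullet> ?e)))"
      unfolding abs_mult
    proof (intro mult_mono Cauchy_Schwarz_ineq2)
      have "\<bar>exp (a \<bullet> ?e) - 1\<bar> \<le> \<bar>a \<bullet> ?e\<bar> * (1 + exp (a \<bullet> ?e))" by (rule abs_exp_minus_one_le)
      also have "\<dots> \<le> (norm a * norm ?e) * (1 + exp (a \<bullet> ?e))"
        by (intro mult_right_mono Cauchy_Schwarz_ineq2) (simp add: add_nonneg_nonneg)
      finally show "\<bar>exp (a \<bullet> ?e) - 1\<bar> \<le> (norm a * norm ?e) * (1 + exp (a \<bullet> ?e))" .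
    qed auto
    from mult_right_mono[OF this, of "\<bar>J y\<bar>"]
    have "\<bar>(u \<bullet> ?e) * (exp (a \<bullet> ?e) - 1) * J y\<bar> \<le>
        norm u * norm ?e * (norm a * norm ?e * (1 + exp (a \<bullet> ?e))) * \<bar>J y\<bar>"
      by (simp only: abs_mult[of _ "J y"] abs_ge_zero)
    moreover have "\<bar>tilt a J y\<bar> = exp (a \<bullet> ?e) * \<bar>J y\<bar>"
      by (simp add: tilt_def abs_mult)
    ultimately
    show "norm ((u \<bullet> ?e) * tilt a J y + - ((u \<bullet> ?e) * J y)) \<le> norm u * norm a * ?N y"
      by (simp add: tilt_def power2_eq_square algebra_simps)
  qed
  also have "\<dots> \<le> (norm u * norm a) * (M + M)"
    using 0 a by (intro mult_left_mono add_mono) (auto simp: regular_def)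
  finally have "norm u * norm u \<le> norm u * (2 * M * norm a)"
    by (simp add: eta_0[OF sym 0] u_def power2_norm_eq_inner[symmetric] power2_eq_square algebra_simps)
  moreover have "0 \<le> M" 
    using infsum_nonneg[of UNIV "\<lambda>y. \<bar>J y\<bar>"] 0 by (auto simp: regular_def)
  ultimately show ?thesis
    unfolding u_def[symmetric] by (cases "norm u = 0") (auto simp: mult_le_cancel_left)
qed

subsection \<open>Convolutions and the susceptibility\<close>

text \<open>Fubini: for fixed \<open>y\<close> the sum over \<open>x\<close> is a shift of the sum
  of \<open>P\<close>. The same computation with absolute values gives the joint summability that
  justifies the exchange.\<close>

lemma infsum_convolution:
  fixes P R :: "int ^ 'n \<Rightarrow> real"
  assumes P: "P summable_on UNIV" and R: "R summable_on UNIV"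
  shows "((\<lambda>x. \<Sum>\<^sub>\<infinity>y. P (x - y) * R y) has_sum infsum P UNIV * infsum R UNIV) UNIV"
proof -
  have bij: "bij (\<lambda>x::int ^ 'n. x - y)" for y
    by (rule bij_betw_byWitness[where f' = "\<lambda>x. x + y"]) auto
  have shift: "((\<lambda>x. P (x - y) * R y) has_sum infsum P UNIV * R y) UNIV" for y
    by (rule has_sum_cmult_left) (simp add: has_sum_reindex_bij_betw[OF bij] P)
  have aP: "(\<lambda>x. \<bar>P x\<bar>) summable_on UNIV" and aR: "(\<lambda>x. \<bar>R x\<bar>) summable_on UNIV"
    using P R summable_on_iff_abs_summable_on_real[of P UNIV] summable_on_iff_abs_summable_on_real[of R UNIV] by auto
  have ashift: "((\<lambda>x. \<bar>P (x - y)\<bar> * \<bar>R y\<bar>) has_sum (\<Sum>\<^sub>\<infinity>x. \<bar>P x\<bar>) * \<bar>R y\<bar>) UNIV" for y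
    by (rule has_sum_cmult_left) (use aP in \<open>simp add: has_sum_reindex_bij_betw[OF bij, where f = "\<lambda>x. \<bar>P x\<bar>"]\<close>)
  have "(\<lambda>(y, x). \<bar>P (x - y)\<bar> * \<bar>R y\<bar>) summable_on UNIV \<times> UNIV"
    by (rule summable_on_SigmaI[where g = "\<lambda>y. (\<Sum>\<^sub>\<infinity>x. \<bar>P x\<bar>) * \<bar>R y\<bar>"])
      (use ashift aR in \<open>auto intro: summable_on_cmult_right\<close>)
  then have s: "(\<lambda>(y, x). P (x - y) * R y) summable_on UNIV \<times> UNIV"
    by (rule summable_on_real_comparison) (auto simp: abs_mult)
  have "((\<lambda>y. infsum P UNIV * R y) has_sum infsum P UNIV * infsum R UNIV) UNIV"
    by (intro has_sum_cmult_right) (simp add: R)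
  with s have "((\<lambda>(y, x). P (x - y) * R y) has_sum infsum P UNIV * infsum R UNIV) (UNIV \<times> UNIV)"
    by (intro has_sum_SigmaI[where g = "\<lambda>y. infsum P UNIV * R y"]) (use shift in auto)
  then have sw: "((\<lambda>(x, y). P (x - y) * R y) has_sum infsum P UNIV * infsum R UNIV) (UNIV \<times> UNIV)"
    by (subst (asm) has_sum_swap) simp
  then have "(\<lambda>(x, y). P (x - y) * R y) summable_on UNIV \<times> UNIV"
    by (rule has_sum_imp_summable)
  then have "(\<lambda>y. P (x - y) * R y) summable_on UNIV" for x
    by (rule summable_on_SigmaD1) simp
  then show ?thesis
    by (intro has_sum_SigmaD[OF sw]) auto
qed

text \<open>For nonnegative terms, both sides say that the finite partial sums are bounded. This
  passes from \<open>ennreal\<close> to real series.\<close>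

lemma suscept_finite_iff:
  assumes "\<And>x. 0 \<le> S x"
  shows "\<mu> \<in> Omega S \<longleftrightarrow> tilt \<mu> S summable_on UNIV"
proof -
  have nn: "0 \<le> tilt \<mu> S x" for x
    using assms by (simp add: tilt_def)
  have eq: "suscept S \<mu> = (SUP F\<in>{F. finite F}. ennreal (sum (tilt \<mu> S) F))"
    unfolding suscept_def by (subst nonneg_infsum_complete) (simp_all add: sum_ennreal nn)
  show ?thesis
  proof
    assume "\<mu> \<in> Omega S"
    then obtain r where r: "suscept S \<mu> = ennreal r" "0 \<le> r"
      unfolding Omega_def by (cases "suscept S \<mu>") auto
    have "sum (tilt \<mu> S) F \<le> r" if "finite F" for F
    proof -
      have "ennreal (sum (tilt \<mu> S) F) \<le> ennreal r"
        unfolding r(1)[symmetric] eq by (rule SUP_upper) (use that in simp)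
      then show ?thesis using r(2) by (simp add: ennreal_le_iff)
    qed
    then show "tilt \<mu> S summable_on UNIV"
      by (intro nonneg_bdd_above_summable_on nn bdd_aboveI2) auto
  next
    assume s: "tilt \<mu> S summable_on UNIV"
    have "suscept S \<mu> \<le> ennreal (infsum (tilt \<mu> S) UNIV)"
      unfolding eq by (intro SUP_least ennreal_leI finite_sum_le_infsum s) (auto simp: nn)
    then show "\<mu> \<in> Omega S"
      using le_less_trans[OF _ ennreal_less_top] by (auto simp: Omega_def)
  qed
qed

lemma convex_Omega:
  assumes "\<And>x. 0 \<le> S x"
  shows "convex (Omega S)"
  unfolding convex_alt
proof (intro ballI allI impI)
  fix a b and u :: real
  assume a: "a \<in> Omega S" and b: "b \<in> Omega S" and u: "0 \<le> u \<and> u \<le> 1"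
  have "(\<lambda>y. \<bar>tilt a S y\<bar> + \<bar>tilt b S y\<bar>) summable_on UNIV"
    using a b summable_on_iff_abs_summable_on_real[of "tilt a S" UNIV]
      summable_on_iff_abs_summable_on_real[of "tilt b S" UNIV]
    by (intro summable_on_add) (auto simp: suscept_finite_iff assms)
  then have "tilt ((1 - u) *\<^sub>R a + u *\<^sub>R b) S summable_on UNIV"
    by (rule summable_on_real_comparison) (use u abs_tilt_interpolate_le in blast)
  then show "(1 - u) *\<^sub>R a + u *\<^sub>R b \<in> Omega S"
    by (simp add: suscept_finite_iff assms)
qed

lemma Omega_uminus:
  assumes "\<And>x. 0 \<le> S x" "Zd_symmetric S" "\<mu> \<in> Omega S"
  shows "- \<mu> \<in> Omega S"
proof -
  have "tilt (- \<mu>) S y = tilt \<mu> S (- y)" for y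
    using Zd_symmetric_uminus[OF assms(2)] by (simp add: tilt_def emb_uminus)
  then show ?thesis
    using assms summable_on_uminus_reindex[of "tilt \<mu> S"]
    by (simp add: suscept_finite_iff cong: summable_on_cong)
qed

text \<open>Transposing coordinates \<open>i\<close> and \<open>j\<close> preserves
  \<open>S\<close>, so the finiteness threshold is the same along every axis.\<close>

lemma Omega_axis:
  assumes nn: "\<And>x. 0 \<le> S x" and sym: "Zd_symmetric S" and t: "t *\<^sub>R axis i 1 \<in> Omega S"
  shows "t *\<^sub>R axis j 1 \<in> Omega S"
proof -
  define p where "p = Transposition.transpose i j"
  define T where "T = (\<lambda>x::int ^ 'a. \<chi> l. x $ p l)"
  have p: "p (p l) = l" for l by (simp add: p_def)
  have "bij p" unfolding p_def by (rule bij_transpose)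
  then have S: "S (T x) = S x" for x
    using sym by (simp add: Zd_symmetric_def T_def)
  have "T (T x) = x" for x by (simp add: T_def p vec_eq_iff)
  then have bij: "bij T"
    by (intro bij_betw_byWitness[where f' = T]) auto
  have "tilt (t *\<^sub>R axis i 1) S (T y) = tilt (t *\<^sub>R axis j 1) S y" for y
    unfolding tilt_def S by (simp add: inner_axis' emb_def T_def p_def)
  then show ?thesis
    using t nn summable_on_reindex_bij_betw[OF bij, of "tilt (t *\<^sub>R axis i 1) S"]
    by (simp add: suscept_finite_iff cong: summable_on_cong)
qed

subsection \<open>The closure of the domain of finiteness\<close>

text \<open>The hypothesis is tested at \<open>u - t *\<^sub>R \<eta>\<close> with \<open>t\<close>
  slightly beyond the projection coefficient of \<open>u\<close> on \<open>\<eta>\<close>. Letting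
  \<open>t\<close> decrease to that coefficient forces equality in the Cauchy-Schwarz
  inequality.\<close>

lemma collinear_if_polar:
  fixes u \<eta> :: "'a::real_inner"
  assumes polar: "\<And>v. v \<bullet> \<eta> < 0 \<Longrightarrow> v \<bullet> u \<le> 0" and nz: "\<eta> \<noteq> 0"
  shows "norm u *\<^sub>R \<eta> = norm \<eta> *\<^sub>R u"
proof -
  let ?c = "u \<bullet> \<eta>"
  have pos: "0 < \<eta> \<bullet> \<eta>" using nz by simp
  have c: "0 \<le> ?c" using polar[of "- \<eta>"] pos by (simp add: inner_commute)
  have bound: "u \<bullet> u \<le> t * ?c" if "?c / (\<eta> \<bullet> \<eta>) < t" for t
  proof -
    have "(u - t *\<^sub>R \<eta>) \<bullet> \<eta> < 0"
      using that pos by (simp add: inner_diff_left field_simps)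
    from polar[OF this] show ?thesis by (simp add: inner_diff_left inner_diff_right inner_commute)
  qed
  have "(u \<bullet> u) * (\<eta> \<bullet> \<eta>) \<le> ?c\<^sup>2"
  proof (cases "?c = 0")
    case True
    then have "u \<bullet> u \<le> 0" using bound[of 1] by simp
    then have "u = 0" by (metis inner_eq_zero_iff inner_ge_zero order_antisym)
    then show ?thesis by simp
  next
    case False
    with c have "0 < ?c" by simp
    have "u \<bullet> u / ?c \<le> ?c / (\<eta> \<bullet> \<eta>)"
      by (rule dense_ge) (use bound \<open>0 < ?c\<close> in \<open>simp add: field_simps\<close>)
    then show ?thesis using \<open>0 < ?c\<close> pos by (simp add: field_simps power2_eq_square)
  qed
  then have "(norm u * norm \<eta>)\<^sup>2 \<le> ?c\<^sup>2"
    by (simp add: power_mult_distrib power2_norm_eq_inner)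
  then have "norm u * norm \<eta> \<le> ?c" using c by (rule power2_le_imp_le)
  then have "?c = norm u * norm \<eta>" using norm_cauchy_schwarz[of u \<eta>] by linarith
  then show ?thesis by (simp add: norm_cauchy_schwarz_eq)
qed

lemma norm_add_sq_le: "(norm (a + b))\<^sup>2 \<le> 2 * (norm a)\<^sup>2 + 2 * (norm b)\<^sup>2" for a b :: "'a::real_inner"
proof -
  have "0 \<le> (norm (a - b))\<^sup>2" by simp
  then show ?thesis
    by (simp add: power2_norm_eq_inner inner_add_left inner_add_right inner_diff_left inner_diff_right
        inner_commute)
qed

section \<open>The renewal identity and the values of the tilted sum\<close>

locale tilted_renewal =
  fixes S J h :: "int ^ 'n \<Rightarrow> real" and M K \<zeta> :: real and i :: 'n
  assumes S_nonneg: "\<And>x. 0 \<le> S x" and zeta_pos: "0 < \<zeta>" and M_pos: "0 < M" and K_pos: "0 < K"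
    and assumption1: "assumption1 i S" and assumption2: "weak_assumption2 M K \<zeta> S J h"
begin

lemma S_sym: "Zd_symmetric S" and open_Omega: "open (Omega S)" and zero_in_Omega: "0 \<in> Omega S"
  using assumption1 by (auto simp: assumption1_def)

lemma J_sym: "Zd_symmetric J" and renewal: "S x = h x + conv J S x"
  using assumption2 by (auto simp: weak_assumption2_def)

lemma regular_J: "\<mu> \<in> closure (Omega S) \<Longrightarrow> regular M K (tilt \<mu> J)"
  using assumption2 zeta_pos by (auto simp: weak_assumption2_def intro: tilted_bounds_regular)

lemma convex_Omega_S: "convex (Omega S)"
  by (rule convex_Omega) (rule S_nonneg)

lemma convex_closure_Omega: "convex (closure (Omega S))"
  using convex_Omega_S by simp

lemma zero_in_closure: "0 \<in> closure (Omega S)"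
  using zero_in_Omega closure_subset by auto

lemma regular_J0: "regular M K J"
  using regular_J[OF zero_in_closure] by simp

lemma eta_J0: "eta J 0 = 0"
  by (rule eta_0[OF J_sym regular_J0])

lemma frontier_Omega: "frontier (Omega S) = closure (Omega S) - Omega S"
  using open_Omega by (simp add: frontier_def interior_open)

lemma tilt_h:
  assumes "\<mu> \<in> closure (Omega S)"
  shows "tilt \<mu> h summable_on UNIV" "0 < tilt_sum h \<mu>" "tilt_sum h \<mu> \<le> M"
proof -
  have h: "lp_norm_le 1 (tilt \<mu> h) M" and pos: "0 < Re (fourier (tilt \<mu> h) 0)"
    using assumption2 assms by (auto simp: weak_assumption2_def tilted_bounds_def)
  from h have a: "(\<lambda>y. \<bar>tilt \<mu> h y\<bar>) summable_on UNIV" and M: "(\<Sum>\<^sub>\<infinity>y. \<bar>tilt \<mu> h y\<bar>) \<le> M"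
    by (auto simp: lp_norm_le_1_iff)
  show s: "tilt \<mu> h summable_on UNIV"
    using a summable_on_iff_abs_summable_on_real[of "tilt \<mu> h" UNIV] by simp
  show "0 < tilt_sum h \<mu>"
    using pos Re_fourier[OF a, of 0] by (simp add: tilt_sum_def)
  have "tilt_sum h \<mu> \<le> (\<Sum>\<^sub>\<infinity>y. \<bar>tilt \<mu> h y\<bar>)"
    unfolding tilt_sum_def by (rule infsum_mono[OF s a]) simp
  then show "tilt_sum h \<mu> \<le> M" using M by linarith
qed

lemma tilt_sum_S_nonneg: "0 \<le> tilt_sum S \<mu>"
  unfolding tilt_sum_def by (rule infsum_nonneg) (simp add: tilt_def S_nonneg)

text \<open>The exponential weight is multiplicative, so tilting commutes with convolution, and
  summation turns the convolution into a product.\<close>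

lemma renewal_tilt_sum:
  assumes "\<mu> \<in> Omega S"
  shows "tilt_sum S \<mu> * (1 - tilt_sum J \<mu>) = tilt_sum h \<mu>"
proof -
  have W: "\<mu> \<in> closure (Omega S)" using assms closure_subset by auto
  have S: "tilt \<mu> S summable_on UNIV" using assms by (simp add: suscept_finite_iff S_nonneg)
  have J: "tilt \<mu> J summable_on UNIV" using regular_inner(4)[OF regular_J[OF W]] .
  have eq: "tilt \<mu> h x + (\<Sum>\<^sub>\<infinity>y. tilt \<mu> J (x - y) * tilt \<mu> S y) = tilt \<mu> S x" for x
  proof -
    have "emb (x - y) + emb y = emb x" for y
      by (simp add: emb_def vec_eq_iff)
    then have "exp (\<mu> \<bullet> emb (x - y)) * exp (\<mu> \<bullet> emb y) = exp (\<mu> \<bullet> emb x)" for y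
      by (metis exp_add inner_add_right)
    then have "tilt \<mu> J (x - y) * tilt \<mu> S y = (J (x - y) * S y) * exp (\<mu> \<bullet> emb x)" for y
      by (simp add: tilt_def ac_simps)
    then have "(\<Sum>\<^sub>\<infinity>y. tilt \<mu> J (x - y) * tilt \<mu> S y) = conv J S x * exp (\<mu> \<bullet> emb x)"
      by (simp add: conv_def infsum_cmult_left')
    then show ?thesis by (simp add: tilt_def renewal[of x] algebra_simps)
  qed
  have "((\<lambda>x. tilt \<mu> h x + (\<Sum>\<^sub>\<infinity>y. tilt \<mu> J (x - y) * tilt \<mu> S y)) has_sum
      tilt_sum h \<mu> + tilt_sum J \<mu> * tilt_sum S \<mu>) UNIV"
    unfolding tilt_sum_def
    by (intro has_sum_add infsum_convolution J S) (use tilt_h(1)[OF W] in simp)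
  then have "(tilt \<mu> S has_sum tilt_sum h \<mu> + tilt_sum J \<mu> * tilt_sum S \<mu>) UNIV"
    by (simp only: eq)
  then have "tilt_sum S \<mu> = tilt_sum h \<mu> + tilt_sum J \<mu> * tilt_sum S \<mu>"
    unfolding tilt_sum_def[of S] by (rule infsumI)
  then show ?thesis by (simp add: algebra_simps)
qed

lemma tilt_sum_J_less_1:
  assumes "\<mu> \<in> Omega S"
  shows "tilt_sum J \<mu> < 1"
proof -
  have "0 < tilt_sum S \<mu> * (1 - tilt_sum J \<mu>)"
    using renewal_tilt_sum[OF assms] tilt_h(2)[of \<mu>] assms closure_subset by auto
  then show ?thesis using tilt_sum_S_nonneg[of \<mu>] by (auto simp: zero_less_mult_iff)
qed

text \<open>As \<open>0\<close> is interior to the convex set, the segment from \<open>0\<close> to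
  a point of the closure stays in the interior until its far end.\<close>

lemma scaled_in_Omega:
  assumes "\<mu> \<in> closure (Omega S)" "0 \<le> s" "s < 1"
  shows "s *\<^sub>R \<mu> \<in> Omega S"
proof -
  have "\<mu> - (1 - s) *\<^sub>R (\<mu> - 0) \<in> interior (Omega S)"
    by (rule mem_interior_closure_convex_shrink[OF convex_Omega_S _ assms(1)])
      (use assms zero_in_Omega open_Omega in \<open>auto simp: interior_open\<close>)
  then show ?thesis using open_Omega by (simp add: interior_open algebra_simps)
qed

text \<open>The point is approached radially from inside. The tilted sum of \<open>J\<close>
  converges by domination between the tilts at \<open>0\<close> and \<open>\<mu>\<close>, while that
  of \<open>S\<close> becomes arbitrarily large, so the renewal identity with numerator at most
  \<open>M\<close> forces the limit to be \<open>1\<close>.\<close>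

lemma tilt_sum_J_frontier:
  assumes "\<mu> \<in> frontier (Omega S)"
  shows "tilt_sum J \<mu> = 1"
proof -
  have W: "\<mu> \<in> closure (Omega S)" and not: "\<mu> \<notin> Omega S"
    using assms by (auto simp: frontier_Omega)
  have in_Omega: "\<forall>\<^sub>F s in at_left 1. s *\<^sub>R \<mu> \<in> Omega S"
    unfolding eventually_at_left_field
    by (rule exI[of _ 0]) (auto intro: scaled_in_Omega[OF W])
  have T: "\<forall>\<^sub>F s::real in at_left 1. s \<in> {0<..<1}"
    unfolding eventually_at_left_field by (rule exI[of _ 0]) auto
  have dom: "(\<lambda>y. \<bar>tilt 0 J y\<bar> + \<bar>tilt \<mu> J y\<bar>) summable_on UNIV"
    using regular_J0 regular_J[OF W] by (intro summable_on_add) (auto simp: regular_def)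
  have tilt_lim: "((\<lambda>s. tilt (s *\<^sub>R \<mu>) f y) \<longlongrightarrow> tilt \<mu> f y) (at_left 1)" for f :: "int ^ 'n \<Rightarrow> real" and y
  proof -
    have "((\<lambda>s. f y * exp (s * (\<mu> \<bullet> emb y))) \<longlongrightarrow> f y * exp (1 * (\<mu> \<bullet> emb y))) (at_left 1)"
      by (intro tendsto_intros)
    then show ?thesis by (simp add: tilt_def)
  qed
  have lim: "((\<lambda>s. tilt_sum J (s *\<^sub>R \<mu>)) \<longlongrightarrow> tilt_sum J \<mu>) (at_left 1)"
    unfolding tilt_sum_def
  proof (rule infsum_dominated_convergence[OF dom _ tilt_lim _ T])
    show "\<bar>tilt (s *\<^sub>R \<mu>) J y\<bar> \<le> \<bar>tilt 0 J y\<bar> + \<bar>tilt \<mu> J y\<bar>" if "s \<in> {0<..<1}" for s y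
      using abs_tilt_interpolate_le[of s 0 \<mu> J y] that by simp
  qed auto
  have "tilt_sum J \<mu> \<le> 1"
    by (rule tendsto_upperbound[OF lim])
      (use in_Omega in \<open>auto elim!: eventually_mono dest: tilt_sum_J_less_1\<close>)
  moreover have large: "1 - M / B \<le> tilt_sum J \<mu>" if "0 < B" for B
  proof (rule tendsto_lowerbound[OF lim])
    have nn: "0 \<le> tilt \<nu> S y" for \<nu> y by (simp add: tilt_def S_nonneg)
    \<comment> \<open>Divergence at \<open>\<mu>\<close> is used through one finite partial sum
      exceeding \<open>B\<close>; by continuity it still exceeds \<open>B\<close> for
      \<open>s\<close> close to \<open>1\<close>.\<close>
    have "\<not> bdd_above (sum (tilt \<mu> S) ` {F. F \<subseteq> UNIV \<and> finite F})"
      using not nn nonneg_bdd_above_summable_on[of UNIV "tilt \<mu> S"]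
      by (auto simp: suscept_finite_iff S_nonneg)
    then obtain A where A: "finite A" "B < sum (tilt \<mu> S) A"
      unfolding bdd_above_def by (force simp: not_le)
    have "((\<lambda>s. sum (tilt (s *\<^sub>R \<mu>) S) A) \<longlongrightarrow> sum (tilt \<mu> S) A) (at_left 1)"
      by (intro tendsto_sum tilt_lim)
    then have "\<forall>\<^sub>F s in at_left 1. B < sum (tilt (s *\<^sub>R \<mu>) S) A"
      using A(2) by (rule order_tendstoD)
    then show "\<forall>\<^sub>F s in at_left 1. 1 - M / B \<le> tilt_sum J (s *\<^sub>R \<mu>)"
      using in_Omega
    proof eventually_elim
      case (elim s)
      let ?\<nu> = "s *\<^sub>R \<mu>"
      have "sum (tilt ?\<nu> S) A \<le> tilt_sum S ?\<nu>"
        unfolding tilt_sum_def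
        by (rule finite_sum_le_infsum) (use elim A nn in \<open>auto simp: suscept_finite_iff S_nonneg\<close>)
      with elim have "B \<le> tilt_sum S ?\<nu>" by linarith
      then have "B * (1 - tilt_sum J ?\<nu>) \<le> tilt_sum S ?\<nu> * (1 - tilt_sum J ?\<nu>)"
        using tilt_sum_J_less_1[OF elim(2)] by (intro mult_right_mono) auto
      also have "\<dots> \<le> M"
        using renewal_tilt_sum[OF elim(2)] tilt_h(3)[of ?\<nu>] elim(2) closure_subset by auto
      finally show ?case using \<open>0 < B\<close> by (simp add: field_simps)
    qed
  qed auto
  moreover have "1 \<le> tilt_sum J \<mu>"
  proof (rule ccontr)
    assume "\<not> 1 \<le> tilt_sum J \<mu>"
    then have d: "0 < 1 - tilt_sum J \<mu>" by simp
    \<comment> \<open>With this choice of \<open>B\<close>, \<open>M / B\<close> is half the gap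
      \<open>1 - tilt_sum J \<mu>\<close>, so a positive gap would be at most half of
      itself.\<close>
    from large[of "2 * M / (1 - tilt_sum J \<mu>)"] d M_pos show False
      by (simp add: field_simps)
  qed
  ultimately show ?thesis by linarith
qed

lemma tilt_sum_J_le_1:
  assumes "\<mu> \<in> closure (Omega S)"
  shows "tilt_sum J \<mu> \<le> 1"
  using assms tilt_sum_J_less_1[of \<mu>] tilt_sum_J_frontier[of \<mu>]
  by (cases "\<mu> \<in> Omega S") (simp_all add: frontier_Omega)

lemma tilt_sum_J_eq_1_iff:
  "\<mu> \<in> closure (Omega S) \<Longrightarrow> tilt_sum J \<mu> = 1 \<longleftrightarrow> \<mu> \<in> frontier (Omega S)"
  using tilt_sum_J_less_1[of \<mu>] tilt_sum_J_frontier[of \<mu>] by (auto simp: frontier_Omega)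

section \<open>Strong convexity and the shape of the closure\<close>

lemma strong_convexity:
  assumes "a \<in> closure (Omega S)" "b \<in> closure (Omega S)"
  shows "tilt_sum J a + eta J a \<bullet> (b - a) + K * (norm (b - a))\<^sup>2 \<le> tilt_sum J b"
  by (intro taylor_lower[where M = M] regular_J convexD_alt[OF convex_closure_Omega assms])

lemma norm_sq_le_growth:
  "\<mu> \<in> closure (Omega S) \<Longrightarrow> K * (norm \<mu>)\<^sup>2 \<le> tilt_sum J \<mu> - tilt_sum J 0"
  using strong_convexity[OF zero_in_closure, of \<mu>] by (simp add: eta_J0)

lemma norm_sq_le:
  assumes "\<mu> \<in> closure (Omega S)"
  shows "(norm \<mu>)\<^sup>2 \<le> M / K"
  using norm_sq_le_growth[OF assms] tilt_sum_growth_le[OF J_sym regular_J0 regular_J[OF assms]] K_pos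
  by (simp add: field_simps)

text \<open>The vectors from \<open>c\<close> to \<open>a\<close> and to \<open>b\<close> are
  opposite, so the gradient at \<open>c\<close> is nonnegative along one of them. Strong convexity
  towards that end point puts the value at \<open>c\<close> strictly below \<open>1\<close>, which
  excludes the frontier.\<close>

lemma open_segment_in_Omega:
  assumes a: "a \<in> closure (Omega S)" and b: "b \<in> closure (Omega S)" and c: "c \<in> open_segment a b"
  shows "c \<in> Omega S"
proof -
  obtain u where ab: "a \<noteq> b" and u: "0 < u" "u < 1" and cu: "c = (1 - u) *\<^sub>R a + u *\<^sub>R b"
    using c by (auto simp: in_segment)
  have cW: "c \<in> closure (Omega S)"
    unfolding cu using u by (intro convexD_alt[OF convex_closure_Omega a b]) auto
  have ac: "a - c = u *\<^sub>R (a - b)" and bc: "b - c = (1 - u) *\<^sub>R (b - a)"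
    by (simp_all add: cu algebra_simps)
  have pos: "0 < K * (norm (a - c))\<^sup>2" "0 < K * (norm (b - c))\<^sup>2"
    unfolding ac bc using ab u K_pos by auto
  have "tilt_sum J c < 1"
  proof (cases "0 \<le> eta J c \<bullet> (a - b)")
    case True
    then have "0 \<le> eta J c \<bullet> (a - c)" unfolding ac using u by simp
    then show ?thesis
      using strong_convexity[OF cW a] pos tilt_sum_J_le_1[OF a] by linarith
  next
    case False
    then have "0 \<le> eta J c \<bullet> (b - a)" by (simp add: inner_diff_right)
    then have "0 \<le> eta J c \<bullet> (b - c)" unfolding bc using u by simp
    then show ?thesis
      using strong_convexity[OF cW b] pos tilt_sum_J_le_1[OF b] by linarith
  qed
  then show ?thesis using cW tilt_sum_J_frontier[of c] by (auto simp: frontier_Omega)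
qed

lemma strictly_convex_closure: "strictly_convex (closure (Omega S))"
  unfolding strictly_convex_def
  using open_segment_in_Omega interior_maximal[OF closure_subset open_Omega] by blast

section \<open>Maximisers of linear functionals\<close>

lemma not_maximal_in_Omega:
  assumes "\<mu> \<in> Omega S" "x \<noteq> 0"
  shows "\<exists>\<nu>\<in>Omega S. \<mu> \<bullet> x < \<nu> \<bullet> x"
proof -
  obtain e where e: "0 < e" "ball \<mu> e \<subseteq> Omega S"
    using open_Omega assms(1) by (auto simp: open_contains_ball)
  let ?\<nu> = "\<mu> + (e / 2 / norm x) *\<^sub>R x"
  have "dist \<mu> ?\<nu> < e" using assms(2) e(1) by (simp add: dist_norm)
  moreover have "\<mu> \<bullet> x < ?\<nu> \<bullet> x"
    using assms(2) e(1) by (simp add: inner_add_left)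
  ultimately show ?thesis using e(2) by (intro bexI[of _ ?\<nu>]) auto
qed

lemma compact_closure_Omega: "compact (closure (Omega S))"
proof -
  have "norm \<mu> \<le> sqrt (M / K)" if "\<mu> \<in> closure (Omega S)" for \<mu>
    using norm_sq_le[OF that] by (rule real_le_rsqrt)
  then show ?thesis by (auto simp: compact_eq_bounded_closed bounded_iff)
qed

lemma bounded_Omega: "bounded (Omega S)"
  by (rule bounded_subset[OF compact_imp_bounded[OF compact_closure_Omega] closure_subset])

text \<open>Compactness gives a maximiser, and it cannot lie in the open set \<open>Omega S\<close>.
  Two distinct maximisers would have a midpoint in \<open>Omega S\<close> that is also
  maximal.\<close>

lemma ex1_boundary_maximiser:
  assumes "x \<noteq> 0"
  shows "\<exists>!\<nu>. boundary_maximiser S x \<nu>"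
proof -
  have "\<exists>\<mu>\<in>closure (Omega S). \<forall>\<nu>\<in>closure (Omega S). \<nu> \<bullet> x \<le> \<mu> \<bullet> x"
    using zero_in_closure
    by (intro continuous_attains_sup compact_closure_Omega) (auto intro!: continuous_intros)
  then obtain \<mu> where \<mu>: "\<mu> \<in> closure (Omega S)" "\<And>\<nu>. \<nu> \<in> closure (Omega S) \<Longrightarrow> \<nu> \<bullet> x \<le> \<mu> \<bullet> x"
    by auto
  have "\<mu> \<notin> Omega S"
    using not_maximal_in_Omega[OF _ assms, of \<mu>] \<mu>(2) closure_subset[of "Omega S"] by force
  then have "boundary_maximiser S x \<mu>"
    using \<mu> by (auto simp: boundary_maximiser_def frontier_Omega)
  moreover have "a = b" if "boundary_maximiser S x a" "boundary_maximiser S x b" for a b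
  proof (rule ccontr)
    assume "a \<noteq> b"
    have W: "a \<in> closure (Omega S)" "b \<in> closure (Omega S)"
      and max: "\<And>\<nu>. \<nu> \<in> closure (Omega S) \<Longrightarrow> \<nu> \<bullet> x \<le> a \<bullet> x"
        "\<And>\<nu>. \<nu> \<in> closure (Omega S) \<Longrightarrow> \<nu> \<bullet> x \<le> b \<bullet> x"
      using that by (auto simp: boundary_maximiser_def frontier_Omega)
    have "midpoint a b \<in> Omega S"
      using \<open>a \<noteq> b\<close> by (intro open_segment_in_Omega[OF W]) simp
    from not_maximal_in_Omega[OF this assms] obtain \<nu> where
      \<nu>: "\<nu> \<in> Omega S" "midpoint a b \<bullet> x < \<nu> \<bullet> x" by auto
    have "a \<bullet> x = b \<bullet> x" using max(1)[OF W(2)] max(2)[OF W(1)] by linarith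
    then have "midpoint a b \<bullet> x = a \<bullet> x"
      by (simp add: midpoint_def inner_add_left)
    then show False using \<nu> max(1)[of \<nu>] closure_subset by force
  qed
  ultimately show ?thesis by blast
qed

section \<open>The gradient as normal direction\<close>

lemma eta_inner_frontier:
  assumes "\<mu> \<in> frontier (Omega S)"
  shows "0 < eta J \<mu> \<bullet> \<mu>" "K * (norm \<mu>)\<^sup>2 \<le> eta J \<mu> \<bullet> \<mu>"
proof -
  have "\<mu> \<in> closure (Omega S)" using assms by (simp add: frontier_Omega)
  \<comment> \<open>Strong convexity is applied from \<open>\<mu>\<close> towards \<open>0\<close>,
    where the tilted sum is strictly below its frontier value \<open>1\<close>.\<close>
  from strong_convexity[OF this zero_in_closure]
  have "1 - tilt_sum J 0 + K * (norm \<mu>)\<^sup>2 \<le> eta J \<mu> \<bullet> \<mu>"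
    using tilt_sum_J_frontier[OF assms] by simp
  moreover have "0 < 1 - tilt_sum J 0" "0 \<le> K * (norm \<mu>)\<^sup>2"
    using tilt_sum_J_less_1[OF zero_in_Omega] K_pos by auto
  ultimately show "0 < eta J \<mu> \<bullet> \<mu>" "K * (norm \<mu>)\<^sup>2 \<le> eta J \<mu> \<bullet> \<mu>" by linarith+
qed

text \<open>
  If \<open>\<mu> + s *\<^sub>R v\<close> lies outside \<open>\<Omega>\<close> for small \<open>s\<close>, then the frontier contains a nearby point
  \<open>q = (1 - e) *\<^sub>R (\<mu> + s *\<^sub>R v)\<close> with \<open>e \<ge> 0\<close> small, where \<open>F q = 1\<close>
  contradicts the upper quadratic estimate.
\<close>

lemma polar_boundary_maximiser:
  assumes max: "boundary_maximiser S u \<mu>" and v: "v \<bullet> eta J \<mu> < 0"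
  shows "v \<bullet> u \<le> 0"
proof (rule ccontr)
  assume vu: "\<not> v \<bullet> u \<le> 0"
  have F: "\<mu> \<in> frontier (Omega S)" and W: "\<mu> \<in> closure (Omega S)"
    and m: "\<And>\<nu>. \<nu> \<in> closure (Omega S) \<Longrightarrow> \<nu> \<bullet> u \<le> \<mu> \<bullet> u"
    using max by (auto simp: boundary_maximiser_def frontier_Omega)
  define a where "a = eta J \<mu> \<bullet> \<mu>"
  define b where "b = - (eta J \<mu> \<bullet> v)"
  have a: "0 < a" using eta_inner_frontier[OF F] by (simp add: a_def)
  have b: "0 < b" using v by (simp add: b_def inner_commute)
  \<comment> \<open>\<open>a\<close> and \<open>b\<close> are the first-order decrease rates of the
    tilted sum along \<open>- \<mu>\<close> and \<open>v\<close>; \<open>A\<close> and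
    \<open>B\<close> bound the second-order cost, with \<open>4 * M\<close> from
    \<open>taylor_upper\<close> and \<open>norm_add_sq_le\<close>. The choices of
    \<open>\<epsilon>\<close> and \<open>s\<close> below make the first-order decrease win. Since
    \<open>e\<close> may turn out to be \<open>0\<close>, strictness is arranged in the
    \<open>v\<close> part.\<close>
  define A where "A = 4 * M * (norm \<mu>)\<^sup>2"
  define B where "B = 4 * M * (norm v)\<^sup>2"
  have AB: "0 \<le> A" "0 \<le> B" using M_pos by (auto simp: A_def B_def)
  define \<epsilon> where "\<epsilon> = min (1/2) (a / (A + 1))"
  have \<epsilon>: "0 < \<epsilon>" "\<epsilon> < 1" "\<epsilon> * A \<le> a"
  proof -
    show "0 < \<epsilon>" "\<epsilon> < 1" using a AB by (auto simp: \<epsilon>_def)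
    have "\<epsilon> * A \<le> a / (A + 1) * A" using AB by (intro mult_right_mono) (auto simp: \<epsilon>_def)
    also have "\<dots> \<le> a" using AB a by (simp add: field_simps)
    finally show "\<epsilon> * A \<le> a" .
  qed
  obtain \<delta> where \<delta>: "0 < \<delta>" "ball ((1 - \<epsilon>) *\<^sub>R \<mu>) \<delta> \<subseteq> Omega S"
    using scaled_in_Omega[OF W, of "1 - \<epsilon>"] \<epsilon> open_Omega by (auto simp: open_contains_ball)
  \<comment> \<open>The first entry keeps \<open>(1 - \<epsilon>) *\<^sub>R p\<close> in the ball
    inside \<open>Omega S\<close>, so that the segment from there to \<open>p\<close> crosses the
    frontier.\<close>
  define s where "s = min (\<delta> / (norm v + 1)) (b / (B + 1))"
  have s: "0 < s" "s * norm v < \<delta>" "s * B < b"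
  proof -
    have n: "0 < norm v + 1" by (simp add: add_nonneg_pos)
    show "0 < s" using \<delta>(1) b AB n by (auto simp: s_def)
    have "s * norm v \<le> \<delta> / (norm v + 1) * norm v" by (intro mult_right_mono) (auto simp: s_def)
    also have "\<dots> < \<delta>" using \<delta>(1) n by (simp add: field_simps)
    finally show "s * norm v < \<delta>" .
    have "s * B \<le> b / (B + 1) * B" using AB by (intro mult_right_mono) (auto simp: s_def)
    also have "\<dots> < b" using b AB by (simp add: field_simps)
    finally show "s * B < b" .
  qed
  define p where "p = \<mu> + s *\<^sub>R v"
  have "0 < s * (v \<bullet> u)" using s vu by simp
  then have "\<mu> \<bullet> u < p \<bullet> u" by (simp add: p_def inner_add_left)
  then have "p \<notin> Omega S" using m[of p] closure_subset[of "Omega S"] by force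
  have "dist ((1 - \<epsilon>) *\<^sub>R \<mu>) ((1 - \<epsilon>) *\<^sub>R p) = (1 - \<epsilon>) * (s * norm v)"
    using \<epsilon> s by (simp add: p_def dist_norm scaleR_add_right)
  also have "\<dots> \<le> 1 * (s * norm v)" using \<epsilon> s by (intro mult_right_mono) auto
  finally have "(1 - \<epsilon>) *\<^sub>R p \<in> Omega S" using s \<delta> by auto
  with \<open>p \<notin> Omega S\<close> have "closed_segment ((1 - \<epsilon>) *\<^sub>R p) p \<inter> frontier (Omega S) \<noteq> {}"
    by (intro connected_Int_frontier) auto
  then obtain q where q: "q \<in> closed_segment ((1 - \<epsilon>) *\<^sub>R p) p" and qF: "q \<in> frontier (Omega S)"
    by auto
  obtain w where w: "0 \<le> w" "w \<le> 1" and qw: "q = (1 - w) *\<^sub>R (1 - \<epsilon>) *\<^sub>R p + w *\<^sub>R p"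
    using q by (auto simp: in_segment)
  define e where "e = (1 - w) * \<epsilon>"
  have e: "0 \<le> e" "e \<le> \<epsilon>" using w \<epsilon> by (auto simp: e_def mult_left_le_one_le)
  have qe: "q = (1 - e) *\<^sub>R p" by (simp add: qw e_def algebra_simps)
  define r where "r = (1 - e) * s"
  have r: "0 < r" "r \<le> s" using e \<epsilon> s by (auto simp: r_def mult_left_le_one_le)
  have q\<mu>: "q - \<mu> = (- e) *\<^sub>R \<mu> + r *\<^sub>R v"
    by (simp add: qe p_def r_def algebra_simps)
  have "1 \<le> 1 + eta J \<mu> \<bullet> (q - \<mu>) + 2 * M * (norm (q - \<mu>))\<^sup>2"
    using taylor_upper[OF regular_J[OF W] regular_J, of q] qF F
    by (simp add: tilt_sum_J_frontier) (simp add: frontier_Omega)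
  also have "eta J \<mu> \<bullet> (q - \<mu>) = - e * a - r * b"
    by (simp add: q\<mu> a_def b_def inner_add_right inner_diff_right)
  also have "2 * M * (norm (q - \<mu>))\<^sup>2 \<le> 2 * M * (2 * (norm ((- e) *\<^sub>R \<mu>))\<^sup>2 + 2 * (norm (r *\<^sub>R v))\<^sup>2)"
    unfolding q\<mu> by (intro mult_left_mono norm_add_sq_le) (use M_pos in simp)
  also have "\<dots> = e * (e * A) + r * (r * B)"
    by (simp add: A_def B_def power_mult_distrib power2_eq_square algebra_simps)
  finally have "e * a + r * b \<le> e * (e * A) + r * (r * B)" by simp
  moreover have "e * (e * A) \<le> e * a"
  proof (rule mult_left_mono)
    have "e * A \<le> \<epsilon> * A" using e AB by (intro mult_right_mono)
    then show "e * A \<le> a" using \<epsilon> by linarith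
  qed (use e in simp)
  moreover have "r * (r * B) < r * b"
  proof (rule mult_strict_left_mono)
    have "r * B \<le> s * B" using r AB by (intro mult_right_mono)
    then show "r * B < b" using s by linarith
  qed (use r in simp)
  ultimately show False by linarith
qed

lemma eta_boundary_maximiser:
  assumes "boundary_maximiser S u \<mu>"
  shows "norm u *\<^sub>R eta J \<mu> = norm (eta J \<mu>) *\<^sub>R u"
proof (rule collinear_if_polar)
  have "\<mu> \<in> frontier (Omega S)" using assms by (simp add: boundary_maximiser_def)
  then show "eta J \<mu> \<noteq> 0" using eta_inner_frontier by force
qed (use polar_boundary_maximiser[OF assms] in blast)

section \<open>Comparison of frontier points with the mass\<close>

lemma mass_axis:
  shows "0 < mass i S" "mass i S *\<^sub>R axis i 1 \<in> frontier (Omega S)"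
    "0 \<le> t \<Longrightarrow> t < mass i S \<Longrightarrow> t *\<^sub>R axis j 1 \<in> Omega S"
proof -
  have 0: "(0 :: real ^ 'n) \<in> interior (Omega S)"
    using zero_in_Omega open_Omega by (simp add: interior_open)
  have "axis i (1::real) \<noteq> 0" by simp
  from ray_to_frontier[OF bounded_Omega 0 this] obtain d where d: "0 < d"
    and dF: "0 + d *\<^sub>R axis i (1::real) \<in> frontier (Omega S)"
    and din: "\<And>e. 0 \<le> e \<Longrightarrow> e < d \<Longrightarrow> 0 + e *\<^sub>R axis i (1::real) \<in> interior (Omega S)"
    by blast
  \<comment> \<open>By convexity the ray cannot re-enter \<open>Omega S\<close> after its first
    frontier point, so the set in the definition of \<open>mass\<close> is exactly
    \<open>{0..<d}\<close>.\<close>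
  have out: "t *\<^sub>R axis i (1::real) \<notin> Omega S" if "d \<le> t" for t
  proof
    assume "t *\<^sub>R axis i (1::real) \<in> Omega S"
    then have "(1 - d/t) *\<^sub>R 0 + (d/t) *\<^sub>R (t *\<^sub>R axis i (1::real)) \<in> Omega S"
      using d that by (intro convexD_alt[OF convex_Omega_S zero_in_Omega]) auto
    then have "d *\<^sub>R axis i (1::real) \<in> Omega S"
      using d that by simp
    then show False using dF by (simp add: frontier_Omega)
  qed
  have "{t. 0 \<le> t \<and> suscept S (t *\<^sub>R axis i 1) < \<infinity>} = {0..<d}"
  proof -
    have "t *\<^sub>R axis i 1 \<in> Omega S \<longleftrightarrow> t < d" if "0 \<le> t" for t
      using out[of t] din[of t] that interior_subset by (force simp: not_less)
    then show ?thesis by (auto simp: Omega_def)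
  qed
  then have m: "mass i S = d"
    using d by (simp add: mass_def)
  show "0 < mass i S" "mass i S *\<^sub>R axis i 1 \<in> frontier (Omega S)"
    using d dF by (simp_all add: m)
  show "t *\<^sub>R axis j 1 \<in> Omega S" if "0 \<le> t" "t < mass i S"
    by (rule Omega_axis[where S = S, OF S_nonneg S_sym, of t i])
      (use din[of t] that interior_subset in \<open>auto simp: m\<close>)
qed

text \<open>Comparing \<open>\<mu>\<close> with the points \<open>t *\<^sub>R axis j 1\<close> and
  their negatives for \<open>t\<close> below the mass bounds each coordinate of \<open>x\<close>.
  Summing over all coordinates gives the factor \<open>CARD('n)\<close>, since the Euclidean norm is
  at most the sum of absolute coordinates.\<close>

lemma boundary_maximiser_inner_ge:
  assumes "boundary_maximiser S x \<mu>"
  shows "mass i S * norm x \<le> CARD('n) * (\<mu> \<bullet> x)"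
proof -
  have comp: "mass i S * \<bar>x $ j\<bar> \<le> \<mu> \<bullet> x" for j
  proof (rule field_le_mult_one_interval)
    fix z :: real assume z: "0 < z" "z < 1"
    define t where "t = z * mass i S"
    have t: "0 \<le> t" "t < mass i S" using z mass_axis(1) by (auto simp: t_def)
    have "t *\<^sub>R axis j 1 \<in> closure (Omega S)" "- (t *\<^sub>R axis j 1) \<in> closure (Omega S)"
      using mass_axis(3)[OF t, of j] Omega_uminus[where S = S, OF S_nonneg S_sym] closure_subset by blast+
    then have "(t *\<^sub>R axis j 1) \<bullet> x \<le> \<mu> \<bullet> x" "- (t *\<^sub>R axis j 1) \<bullet> x \<le> \<mu> \<bullet> x"
      using assms unfolding boundary_maximiser_def by blast+
    then have "t * \<bar>x $ j\<bar> \<le> \<mu> \<bullet> x"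
      using t by (auto simp: inner_axis' abs_if)
    then show "z * (mass i S * \<bar>x $ j\<bar>) \<le> \<mu> \<bullet> x" by (simp add: t_def mult.assoc)
  qed
  have "mass i S * norm x \<le> mass i S * (\<Sum>j\<in>UNIV. \<bar>x $ j\<bar>)"
    using mass_axis(1) by (intro mult_left_mono norm_le_l1_cart) simp
  also have "\<dots> = (\<Sum>j\<in>UNIV. mass i S * \<bar>x $ j\<bar>)" by (rule sum_distrib_left)
  also have "\<dots> \<le> (\<Sum>j\<in>(UNIV::'n set). \<mu> \<bullet> x)" by (intro sum_mono comp)
  finally show ?thesis by simp
qed

text \<open>The growth of the tilted sum from \<open>0\<close> to the frontier is the same at every
  frontier point. It is at least \<open>K\<close> times the squared norm of \<open>\<mu>\<close>
  and, evaluated at the axis point, at most \<open>2 * M\<close> times the squared mass.\<close>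

lemma frontier_norm_le:
  assumes "\<mu> \<in> frontier (Omega S)"
  shows "norm \<mu> \<le> sqrt (2 * M / K) * mass i S"
proof -
  have W: "\<mu> \<in> closure (Omega S)" using assms by (simp add: frontier_Omega)
  let ?m = "mass i S *\<^sub>R axis i 1 :: real ^ 'n"
  have mF: "?m \<in> frontier (Omega S)" by (rule mass_axis)
  then have mW: "?m \<in> closure (Omega S)" by (simp add: frontier_Omega)
  have "K * (norm \<mu>)\<^sup>2 \<le> tilt_sum J ?m - tilt_sum J 0"
    using norm_sq_le_growth[OF W] tilt_sum_J_frontier[OF assms] tilt_sum_J_frontier[OF mF] by linarith
  also have "\<dots> \<le> 2 * M * (norm ?m)\<^sup>2"
    using taylor_upper[of M K 0 J ?m] regular_J0 regular_J[OF mW] by (simp add: eta_J0)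
  also have "norm ?m = mass i S" using mass_axis(1) by (simp add: norm_axis_1)
  finally have "(norm \<mu>)\<^sup>2 \<le> 2 * M / K * (mass i S)\<^sup>2"
    using K_pos by (simp add: field_simps)
  also have "\<dots> = (sqrt (2 * M / K) * mass i S)\<^sup>2"
    using M_pos K_pos by (simp add: power_mult_distrib)
  finally show ?thesis
    by (rule power2_le_imp_le) (use mass_axis(1) M_pos K_pos in simp)
qed

lemma norm_eta_frontier:
  assumes "\<mu> \<in> frontier (Omega S)"
  shows "K * norm \<mu> \<le> norm (eta J \<mu>)" "norm (eta J \<mu>) \<le> 2 * M * norm \<mu>"
proof -
  have "K * (norm \<mu>)\<^sup>2 \<le> norm (eta J \<mu>) * norm \<mu>"
    using eta_inner_frontier(2)[OF assms] norm_cauchy_schwarz[of "eta J \<mu>" \<mu>] by linarith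
  moreover have "0 < norm \<mu>" using eta_inner_frontier(1)[OF assms] by force
  ultimately show "K * norm \<mu> \<le> norm (eta J \<mu>)" by (simp add: power2_eq_square)
  show "norm (eta J \<mu>) \<le> 2 * M * norm \<mu>"
    using assms by (intro norm_eta_le[OF J_sym regular_J0 regular_J]) (simp add: frontier_Omega)
qed

end

section \<open>Assembly with uniform constants\<close>

lemma boundary_maximiser_scaleR:
  assumes "0 < c"
  shows "boundary_maximiser S (c *\<^sub>R x) \<mu> \<longleftrightarrow> boundary_maximiser S x \<mu>"
  using assms by (simp add: boundary_maximiser_def)

text \<open>Choosing \<open>c\<close> and \<open>C\<close> before \<open>S\<close>,
  \<open>J\<close>, \<open>h\<close>, \<open>\<zeta>\<close> and \<open>i\<close> expresses that
  they depend only on the dimension, \<open>M\<close> and \<open>K\<close>.\<close>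

theorem proposition1p4:
  fixes M K :: real
  assumes "M > 0" and "K > 0"
  shows "\<exists>c>0. \<exists>C>0. \<forall>(S :: int ^ 'n \<Rightarrow> real) J h \<zeta> i.
    (\<forall>x. 0 \<le> S x) \<longrightarrow> 0 < \<zeta> \<longrightarrow> assumption1 i S \<longrightarrow> weak_assumption2 M K \<zeta> S J h \<longrightarrow>
      strictly_convex (closure (Omega S)) \<and>
      (\<forall>\<mu>\<in>closure (Omega S). (norm \<mu>)\<^sup>2 \<le> M / K) \<and>
      (\<forall>\<mu>\<in>closure (Omega S).
        (\<Sum>\<^sub>\<infinity>y. tilt \<mu> J y) \<le> 1 \<and>
        ((\<Sum>\<^sub>\<infinity>y. tilt \<mu> J y) = 1 \<longleftrightarrow> \<mu> \<in> frontier (Omega S))) \<and>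
      (\<exists>m :: real ^ 'n \<Rightarrow> real ^ 'n. \<forall>x. x \<noteq> 0 \<longrightarrow>
        (let u = x /\<^sub>R norm x; \<mu> = m u in
          (\<exists>!\<nu>. boundary_maximiser S x \<nu>) \<and>
          boundary_maximiser S x \<mu> \<and>
          eta J \<mu> = norm (eta J \<mu>) *\<^sub>R u \<and>
          c * (mass i S * norm x) \<le> \<mu> \<bullet> x \<and> \<mu> \<bullet> x \<le> C * (mass i S * norm x) \<and>
          c * mass i S \<le> norm (eta J \<mu>) \<and> norm (eta J \<mu>) \<le> C * mass i S \<and>
          (\<forall>k. c * (norm k)\<^sup>2 \<le> k \<bullet> (Lambda J \<mu> *v k) \<and>
               k \<bullet> (Lambda J \<mu> *v k) \<le> C * (norm k)\<^sup>2)))"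
proof -
  define d where "d = real CARD('n)"
  define s where "s = sqrt (2 * M / K)"
  \<comment> \<open>The entries of \<open>c\<close> and of \<open>C\<close> are, in order, the
    constants for the maximum \<open>\<mu> \<bullet> x\<close>, for the norm of \<open>eta\<close>
    and for the quadratic form of \<open>Lambda\<close>.\<close>
  define c where "c = min (1 / d) (min (K / d) (2 * K))"
  define C where "C = max s (max (2 * M * s) M)"
  have d: "0 < d" by (simp add: d_def)
  have c: "0 < c" "c \<le> 1 / d" "c \<le> K / d" "c \<le> 2 * K" using assms d by (auto simp: c_def)
  have C: "0 < C" "s \<le> C" "2 * M * s \<le> C" "M \<le> C" using assms by (auto simp: C_def)
  show ?thesis
  proof (rule exI[of _ c], rule conjI[OF c(1)], rule exI[of _ C], rule conjI[OF C(1)],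
      intro allI impI, goal_cases)
    case (1 S J h \<zeta> i)
    then interpret tilted_renewal S J h M K \<zeta> i
      by unfold_locales (use assms in auto)
    \<comment> \<open>Selecting the maximiser from the unit vector makes it a function of the
      direction alone; positive scaling carries it over to \<open>x\<close>.\<close>
    define m where "m = (\<lambda>u. SOME \<nu>. boundary_maximiser S u \<nu>)"
    show ?case
    proof (unfold Let_def, intro conjI ballI exI[of _ m] allI impI)
      show "strictly_convex (closure (Omega S))" by (rule strictly_convex_closure)
    next
      fix \<mu> assume W: "\<mu> \<in> closure (Omega S)"
      show "(norm \<mu>)\<^sup>2 \<le> M / K" by (rule norm_sq_le[OF W])
      show "(\<Sum>\<^sub>\<infinity>y. tilt \<mu> J y) \<le> 1"
        using tilt_sum_J_le_1[OF W] by (simp add: tilt_sum_def)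
      show "(\<Sum>\<^sub>\<infinity>y. tilt \<mu> J y) = 1 \<longleftrightarrow> \<mu> \<in> frontier (Omega S)"
        using tilt_sum_J_eq_1_iff[OF W] by (simp add: tilt_sum_def)
    next
      fix x :: "real ^ 'n" assume x: "x \<noteq> 0"
      let ?u = "x /\<^sub>R norm x"
      let ?\<mu> = "m ?u"
      have u: "norm ?u = 1" "?u \<noteq> 0" using x by auto
      have max_u: "boundary_maximiser S ?u ?\<mu>"
        unfolding m_def by (rule someI_ex) (use ex1_boundary_maximiser[OF u(2)] in blast)
      then show max_x: "boundary_maximiser S x ?\<mu>"
        using x boundary_maximiser_scaleR[of "inverse (norm x)" S x ?\<mu>] by simp
      show "\<exists>!\<nu>. boundary_maximiser S x \<nu>" by (rule ex1_boundary_maximiser[OF x])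
      show "eta J ?\<mu> = norm (eta J ?\<mu>) *\<^sub>R ?u"
        using eta_boundary_maximiser[OF max_u] u(1) by simp
      have F: "?\<mu> \<in> frontier (Omega S)" using max_u by (simp add: boundary_maximiser_def)
      then have reg: "regular M K (tilt ?\<mu> J)" by (intro regular_J) (simp add: frontier_Omega)
      have mpos: "0 < mass i S" by (rule mass_axis)
      show "c * (mass i S * norm x) \<le> ?\<mu> \<bullet> x"
      proof -
        have "c * (mass i S * norm x) \<le> 1 / d * (mass i S * norm x)"
          using c mpos by (intro mult_right_mono) auto
        also have "\<dots> \<le> ?\<mu> \<bullet> x"
          using boundary_maximiser_inner_ge[OF max_x] d by (simp add: d_def field_simps)
        finally show ?thesis .
      qed
      show "?\<mu> \<bullet> x \<le> C * (mass i S * norm x)"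
      proof -
        have "?\<mu> \<bullet> x \<le> norm ?\<mu> * norm x" by (rule norm_cauchy_schwarz)
        also have "\<dots> \<le> (s * mass i S) * norm x"
          using frontier_norm_le[OF F] by (intro mult_right_mono) (auto simp: s_def)
        also have "\<dots> \<le> (C * mass i S) * norm x"
          using C mpos by (intro mult_right_mono) auto
        finally show ?thesis by (simp add: mult.assoc)
      qed
      show "c * mass i S \<le> norm (eta J ?\<mu>)"
      proof -
        have "mass i S \<le> d * (?\<mu> \<bullet> ?u)"
          using boundary_maximiser_inner_ge[OF max_u] unfolding u(1) d_def by simp
        also have "\<dots> \<le> d * norm ?\<mu>"
          using norm_cauchy_schwarz[of ?\<mu> ?u] d unfolding u(1) by (intro mult_left_mono) auto
        finally have "K / d * mass i S \<le> K / d * (d * norm ?\<mu>)"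
          using assms d by (intro mult_left_mono) auto
        also have "\<dots> = K * norm ?\<mu>" using d by simp
        also have "\<dots> \<le> norm (eta J ?\<mu>)" by (rule norm_eta_frontier[OF F])
        finally show ?thesis
          using mult_right_mono[OF c(3), of "mass i S"] mpos by linarith
      qed
      show "norm (eta J ?\<mu>) \<le> C * mass i S"
      proof -
        have "norm (eta J ?\<mu>) \<le> 2 * M * norm ?\<mu>" by (rule norm_eta_frontier[OF F])
        also have "\<dots> \<le> 2 * M * (s * mass i S)"
          using frontier_norm_le[OF F] assms by (intro mult_left_mono) (auto simp: s_def)
        also have "\<dots> \<le> C * mass i S"
          using mult_right_mono[OF C(3), of "mass i S"] mpos by (simp add: mult.assoc)
        finally show ?thesis .
      qed
      fix k :: "real ^ 'n"
      have "c * (norm k)\<^sup>2 \<le> 2 * K * (norm k)\<^sup>2" using c by (intro mult_right_mono) auto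
      also have "\<dots> \<le> k \<bullet> (Lambda J ?\<mu> *v k)"
        using reg by (simp add: regular_def Lambda_inner[OF reg])
      finally show "c * (norm k)\<^sup>2 \<le> k \<bullet> (Lambda J ?\<mu> *v k)" .
      have "k \<bullet> (Lambda J ?\<mu> *v k) \<le> M * (norm k)\<^sup>2"
        using quad_le[OF reg] by (simp add: Lambda_inner[OF reg])
      also have "\<dots> \<le> C * (norm k)\<^sup>2" using C by (intro mult_right_mono) auto
      finally show "k \<bullet> (Lambda J ?\<mu> *v k) \<le> C * (norm k)\<^sup>2" .
    qed
  qed
qed

end
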